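(* Let $k=\mathbb F_8=\mathbb F_2(\alpha)$, where $\alpha^3=\alpha+1$, and let $G=\langle\sigma,\tau,\rho\rangle\cong C_2^3$ act faithfully on $S=k[x_1,x_2,y_1,y_2]$ by fixing $x_1,x_2$ and by $$\begin{aligned} \sigma(y_1)&=y_1+x_1, & \sigma(y_2)&=y_2+x_2,\\ \tau(y_1)&=y_1+\alpha x_2, & \tau(y_2)&=y_2+x_1,\\ \rho(y_1)&=y_1+\alpha^2x_1, & \rho(y_2)&=y_2+(\alpha+\alpha^2)x_2. \end{aligned}$$ Then $S^G$ has a minimal homogeneous algebra-generating set of degrees $1,1,4,4,6$. Every nonfixed linear form has orbit size $8$. Consequently every nonlinear orbit norm has degree $8$ and belongs to $(S^G_+)^2$. Hence no nonlinear orbit norm can occur in a homogeneous minimal algebra-generating set of $S^G$, and the unrestricted form of Wehlau's norm conjecture is false.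
   Context: $C_2$ is the cyclic group of order $2$. $S$ is the polynomial ring with its standard grading (all variables in degree $1$), and $G$ acts by graded $k$-algebra automorphisms; linear forms are the elements of $S_1$. $S^G$ is the graded subring of $G$-invariants, $S^G_+$ is its ideal of positive-degree elements, and $(S^G_+)^2$ is the square of this ideal in $S^G$. For a linear form $\ell$, the orbit norm is $N_G^{\mathrm{orb}}(\ell)=\prod_{m\in G\ell}m$, the product of the distinct elements of its orbit; it is called nonlinear precisely when $\ell$ is not fixed by $G$. Wehlau's norm conjecture (D. L. Wehlau, "Some problems in invariant theory", 2004, and his web page of conjectures) concerns invariant rings of modular representations (characteristic of the field dividing the group order) that are polynomial algebras; as it is used here, it predicts that some nonlinear orbit norm of a linear form occurs in a homogeneous minimal algebra-generating set of the invariant ring. Its unrestricted form is the stronger assertion in which the invariant ring is not required to be polynomial. *)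

theory Defs
  imports
    "HOL-Library.Poly_Mapping"
    "HOL-Library.Cardinality"
    "HOL-Algebra.Bij"
    "HOL-Algebra.Generated_Groups"
    "HOL-Algebra.Elementary_Groups"
begin

section \<open>Polynomial rings with the standard grading\<close>

text \<open>
  Monomials are exponent vectors and a polynomial is a finitely supported coefficient function
  on them; the product of \<^theory>\<open>HOL-Library.Poly_Mapping\<close> is then polynomial multiplication.
\<close>

type_synonym ('v, 'k) mpoly = "('v \<Rightarrow>\<^sub>0 nat) \<Rightarrow>\<^sub>0 'k"

definition pconst :: "'k::comm_ring_1 \<Rightarrow> ('v, 'k) mpoly" where
  "pconst c = Poly_Mapping.single 0 c"

definition pvar :: "'v \<Rightarrow> ('v, 'k::comm_ring_1) mpoly" where
  "pvar v = Poly_Mapping.single (Poly_Mapping.single v 1) 1"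

definition psubst :: "('v::finite \<Rightarrow> ('v, 'k::comm_ring_1) mpoly) \<Rightarrow> ('v, 'k) mpoly \<Rightarrow> ('v, 'k) mpoly" where
  "psubst h f =
     (\<Sum>m\<in>Poly_Mapping.keys f.
        pconst (Poly_Mapping.lookup f m) * (\<Prod>v\<in>UNIV. h v ^ Poly_Mapping.lookup m v))"

definition mdegree :: "('v::finite \<Rightarrow>\<^sub>0 nat) \<Rightarrow> nat" where
  "mdegree m = (\<Sum>v\<in>UNIV. Poly_Mapping.lookup m v)"

text \<open>The graded piece of degree \<open>d\<close>; it contains \<open>0\<close> for every \<open>d\<close>.\<close>

definition graded_piece :: "nat \<Rightarrow> ('v::finite, 'k::comm_ring_1) mpoly set" where
  "graded_piece d = {f. \<forall>m\<in>Poly_Mapping.keys f. mdegree m = d}"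

abbreviation linear_forms :: "('v::finite, 'k::comm_ring_1) mpoly set" where
  "linear_forms \<equiv> graded_piece 1"

definition graded_alg_auts :: "(('v::finite, 'k::comm_ring_1) mpoly \<Rightarrow> ('v, 'k) mpoly) set" where
  "graded_alg_auts = {\<phi>. bij \<phi> \<and>
     (\<forall>f g. \<phi> (f + g) = \<phi> f + \<phi> g) \<and>
     (\<forall>f g. \<phi> (f * g) = \<phi> f * \<phi> g) \<and>
     (\<forall>c. \<phi> (pconst c) = pconst c) \<and>
     (\<forall>d. \<phi> ` graded_piece d \<subseteq> graded_piece d)}"


section \<open>Generating sets and invariants\<close>

inductive_set alg_gen :: "('v, 'k::comm_ring_1) mpoly set \<Rightarrow> ('v, 'k) mpoly set"
  for A :: "('v, 'k) mpoly set" where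
  const: "pconst c \<in> alg_gen A"
| gen: "f \<in> A \<Longrightarrow> f \<in> alg_gen A"
| add: "f \<in> alg_gen A \<Longrightarrow> g \<in> alg_gen A \<Longrightarrow> f + g \<in> alg_gen A"
| mult: "f \<in> alg_gen A \<Longrightarrow> g \<in> alg_gen A \<Longrightarrow> f * g \<in> alg_gen A"

text \<open>Minimality is with respect to inclusion; in particular \<open>A\<close> contains no constants.\<close>

definition min_hom_gen_set ::
  "('v::finite, 'k::comm_ring_1) mpoly set \<Rightarrow> ('v, 'k) mpoly set \<Rightarrow> bool" where
  "min_hom_gen_set A R \<longleftrightarrow>
     (\<forall>f\<in>A. \<exists>d. f \<in> graded_piece d) \<and> alg_gen A = R \<and> (\<forall>B. B \<subset> A \<longrightarrow> alg_gen B \<noteq> R)"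

text \<open>
  A group of graded automorphisms is given by its underlying set \<open>G\<close>, a subgroup of the group
  \<open>BijGroup UNIV\<close> of all permutations of the polynomial ring, whose multiplication is composition.
\<close>

definition inv_ring :: "(('v, 'k::comm_ring_1) mpoly \<Rightarrow> ('v, 'k) mpoly) set \<Rightarrow> ('v, 'k) mpoly set" where
  "inv_ring G = {f. \<forall>g\<in>G. g f = f}"

text \<open>Positive degree of all homogeneous components amounts to a vanishing constant coefficient.\<close>

definition inv_ring_pos :: "(('v, 'k::comm_ring_1) mpoly \<Rightarrow> ('v, 'k) mpoly) set \<Rightarrow> ('v, 'k) mpoly set" where
  "inv_ring_pos G = {f \<in> inv_ring G. Poly_Mapping.lookup f 0 = 0}"

definition ideal_square :: "('a::comm_ring_1) set \<Rightarrow> 'a set" where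
  "ideal_square I = {\<Sum>i<n. a i * b i | (n::nat) a b. \<forall>i<n. a i \<in> I \<and> b i \<in> I}"

definition form_orbit ::
  "(('v, 'k::comm_ring_1) mpoly \<Rightarrow> ('v, 'k) mpoly) set \<Rightarrow> ('v, 'k) mpoly \<Rightarrow> ('v, 'k) mpoly set" where
  "form_orbit G l = {g l | g. g \<in> G}"

text \<open>The product runs over a set, so each element of the orbit is taken once.\<close>

definition orbit_norm ::
  "(('v, 'k::comm_ring_1) mpoly \<Rightarrow> ('v, 'k) mpoly) set \<Rightarrow> ('v, 'k) mpoly \<Rightarrow> ('v, 'k) mpoly" where
  "orbit_norm G l = (\<Prod>m\<in>form_orbit G l. m)"

definition nonfixed_forms ::
  "(('v::finite, 'k::comm_ring_1) mpoly \<Rightarrow> ('v, 'k) mpoly) set \<Rightarrow> ('v, 'k) mpoly set" where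
  "nonfixed_forms G = linear_forms - inv_ring G"


section \<open>The unrestricted norm conjecture\<close>

text \<open>
  The conjecture for polynomial rings over the field \<open>'k\<close> in variables indexed by \<open>'v\<close>: for every
  finite modular group, some nonlinear orbit norm belongs to some minimal homogeneous generating
  set of the invariant ring, which is not required to be polynomial. The full conjecture is this
  statement for all fields \<open>'k\<close> and all finite index types \<open>'v\<close>, so one failing pair of types
  refutes it. In characteristic \<open>0\<close> the divisibility hypothesis is never satisfied, because
  \<open>card G > 0\<close>.
\<close>

definition unrestricted_norm_conjecture :: "'v::finite itself \<Rightarrow> 'k::field itself \<Rightarrow> bool" where
  "unrestricted_norm_conjecture _ _ \<longleftrightarrow>
     (\<forall>G :: (('v, 'k) mpoly \<Rightarrow> ('v, 'k) mpoly) set.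
        subgroup G (BijGroup UNIV) \<and> G \<subseteq> graded_alg_auts \<and> finite G \<and> CHAR('k) dvd card G \<longrightarrow>
        (\<exists>l\<in>nonfixed_forms G. \<exists>A. min_hom_gen_set A (inv_ring G) \<and> orbit_norm G l \<in> A))"


section \<open>The group of the counterexample\<close>

datatype var = X1 | X2 | Y1 | Y2

instance var :: finite
proof
  have "(UNIV :: var set) = {X1, X2, Y1, Y2}"
    using var.exhaust by blast
  then show "finite (UNIV :: var set)"
    by (metis finite.emptyI finite.insertI)
qed

definition \<sigma> :: "(var, 'k::field) mpoly \<Rightarrow> (var, 'k) mpoly" where
  "\<sigma> = psubst (\<lambda>v. case v of
     X1 \<Rightarrow> pvar X1 | X2 \<Rightarrow> pvar X2
   | Y1 \<Rightarrow> pvar Y1 + pvar X1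
   | Y2 \<Rightarrow> pvar Y2 + pvar X2)"

definition \<tau> :: "'k::field \<Rightarrow> (var, 'k) mpoly \<Rightarrow> (var, 'k) mpoly" where
  "\<tau> \<alpha> = psubst (\<lambda>v. case v of
     X1 \<Rightarrow> pvar X1 | X2 \<Rightarrow> pvar X2
   | Y1 \<Rightarrow> pvar Y1 + pconst \<alpha> * pvar X2
   | Y2 \<Rightarrow> pvar Y2 + pvar X1)"

definition \<rho> :: "'k::field \<Rightarrow> (var, 'k) mpoly \<Rightarrow> (var, 'k) mpoly" where
  "\<rho> \<alpha> = psubst (\<lambda>v. case v of
     X1 \<Rightarrow> pvar X1 | X2 \<Rightarrow> pvar X2
   | Y1 \<Rightarrow> pvar Y1 + pconst (\<alpha>\<^sup>2) * pvar X1
   | Y2 \<Rightarrow> pvar Y2 + pconst (\<alpha> + \<alpha>\<^sup>2) * pvar X2)"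

definition grp :: "'k::field \<Rightarrow> ((var, 'k) mpoly \<Rightarrow> (var, 'k) mpoly) set" where
  "grp \<alpha> = generate (BijGroup UNIV) {\<sigma>, \<tau> \<alpha>, \<rho> \<alpha>}"

abbreviation C2 :: "int monoid" where
  "C2 \<equiv> integer_mod_group 2"

end

(*
  Over K = k(x1,x2) the group acts on K[y1,y2] by translations along a three-dimensional F_2-space, so
  additive polynomials supply the invariants: f and g start with y1^4 and y2^4, and h is quadratic in
  y1, y2 with coefficients in k[x1,x2]. They satisfy h^2 = A^2 f + B^2 g + q h with A, B, q in k[x1,x2],
  where A and B are the leading coefficients of h.

  To see that x1, x2, f, g, h generate, eliminate the involutions sigma, rho, tau in turn. Each time a
  polynomial P + Q t, with P and Q fixed and t moved by the involution, is invariant only if Q = 0.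
  With a suitable t this inverts only x1, so x1^n F lies in k[x1,x2,f,g,h] for every invariant F. The factor x1^n
  can be cancelled because x2, f, g remain algebraically independent modulo x1, with 1 and h independent
  over them.

  All generators have degree at most 6, so an orbit norm, being an invariant of degree 8, is decomposable.
*)

theory Submission
  imports Defs "HOL-Computational_Algebra.Polynomial"
begin

text \<open>A group element changes \<open>d1*y1 + d2*y2\<close> by a form in \<open>x1\<close>,
  \<open>x2\<close>, through a 2x2 matrix over \<open>k\<close>. The constants in the action make
  the determinants of the seven nonidentity elements run through the seven powers of \<alpha>. So a
  form moved by the group has trivial stabilizer and an orbit of full size 8, which exceeds every
  generator degree.

  The degrees of \<open>x1\<close>, \<open>x2\<close>, \<open>f\<close>, \<open>g\<close> multiply
  to 16, twice the group order; this leaves room for exactly one more invariant that is quadratic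
  over them, and \<open>h\<close> is that invariant.

  Removing \<open>\<tau>\<close> is the delicate elimination. The two elements left by then,
  \<open>N'\<close> and \<open>z'\<close>, are shifted by polynomials in \<open>x1\<close> and
  \<open>x2\<close>, and using either of them as \<open>t\<close> would put such a polynomial into
  the denominators. A combination whose shift is exactly \<open>x1^5\<close> avoids this.

  Cancelling \<open>x1\<close> then needs unique remainders modulo \<open>x1\<close>. They are taken
  in the form \<open>P + Q*h\<close> with \<open>P\<close>, \<open>Q\<close> polynomials in
  \<open>x2\<close>, \<open>f\<close>, \<open>g\<close>, and uniqueness is tested at
  \<open>x1 = 0\<close> in iterated univariate polynomials, where degrees in \<open>y1\<close> alone
  make sense.\<close>

instantiation var :: linorder
begin

text \<open>Ordered variables give ordered monomials, and through these the type classes recognize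
  the polynomial ring as a domain. Cancelling \<open>x1\<close> and the shifts of the involutions
  depends on that; which order is chosen is immaterial.\<close>

fun var_rank :: "var \<Rightarrow> nat" where
  "var_rank X1 = 0" | "var_rank X2 = 1" | "var_rank Y1 = 2" | "var_rank Y2 = 3"

definition less_eq_var :: "var \<Rightarrow> var \<Rightarrow> bool" where
  "less_eq_var u v \<longleftrightarrow> var_rank u \<le> var_rank v"

definition less_var :: "var \<Rightarrow> var \<Rightarrow> bool" where
  "less_var u v \<longleftrightarrow> var_rank u < var_rank v"

instance
proof
  fix u v :: var
  show "u \<le> v \<Longrightarrow> v \<le> u \<Longrightarrow> u = v"
    by (cases u; cases v) (auto simp: less_eq_var_def)
qed (auto simp: less_eq_var_def less_var_def)

end

section \<open>Ring homomorphisms and constant polynomials\<close>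

locale rhom =
  fixes \<phi> :: "'a::comm_ring_1 \<Rightarrow> 'b::comm_ring_1"
  assumes add: "\<phi> (x + y) = \<phi> x + \<phi> y"
    and mult: "\<phi> (x * y) = \<phi> x * \<phi> y"
    and one: "\<phi> 1 = 1"
begin

lemma zero: "\<phi> 0 = 0"
  using add[of 0 0] by simp

lemma uminus: "\<phi> (- x) = - \<phi> x"
  using add[of x "- x"] by (simp add: zero eq_neg_iff_add_eq_0 add.commute)

lemma power: "\<phi> (x ^ n) = \<phi> x ^ n"
  by (induction n) (simp_all add: one mult)

lemma prod: "\<phi> (\<Prod>i\<in>I. f i) = (\<Prod>i\<in>I. \<phi> (f i))"
  by (induction I rule: infinite_finite_induct) (simp_all add: one mult)

end

lemma rhom_comp: "rhom \<phi> \<Longrightarrow> rhom \<psi> \<Longrightarrow> rhom (\<lambda>x. \<phi> (\<psi> x))"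
  by (simp add: rhom_def)

lemma rhom_pconst: "rhom (pconst :: 'k::comm_ring_1 \<Rightarrow> ('v, 'k) mpoly)"
  by unfold_locales (simp_all add: pconst_def single_add mult_single)

lemmas pconst_add = rhom.add[OF rhom_pconst]
lemmas pconst_mult = rhom.mult[OF rhom_pconst]
lemmas pconst_power = rhom.power[OF rhom_pconst]
lemmas pconst_0 [simp] = rhom.zero[OF rhom_pconst]
lemmas pconst_1 [simp] = rhom.one[OF rhom_pconst]

lemma pconst_inject [simp]: "(pconst c :: ('v, 'k::comm_ring_1) mpoly) = pconst d \<longleftrightarrow> c = d"
  unfolding pconst_def by (metis lookup_single_eq)

section \<open>Evaluation of polynomials\<close>

text \<open>Besides \<open>psubst\<close>, which is the case \<open>c = pconst\<close>, this covers
  maps into iterated univariate polynomials, as needed for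
  \<open>independent_mod_x1\<close>.\<close>

definition peval ::
  "('k::comm_ring_1 \<Rightarrow> 'r::comm_ring_1) \<Rightarrow> ('v::finite \<Rightarrow> 'r) \<Rightarrow> ('v, 'k) mpoly \<Rightarrow> 'r" where
  "peval c h f =
     (\<Sum>m\<in>Poly_Mapping.keys f. c (Poly_Mapping.lookup f m) * (\<Prod>v\<in>UNIV. h v ^ Poly_Mapping.lookup m v))"

lemma psubst_eq_peval: "psubst h = peval pconst h"
  by (simp add: fun_eq_iff psubst_def peval_def)

lemma mpoly_sum_single:
  "(\<Sum>m\<in>Poly_Mapping.keys f. Poly_Mapping.single m (Poly_Mapping.lookup f m)) = f"
  by (rule poly_mapping_eqI)
     (simp add: lookup_sum lookup_single when_def in_keys_iff)

lemma mpoly_induct [case_names zero single add]: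
  fixes f :: "('v, 'k::comm_ring_1) mpoly"
  assumes "P 0" "\<And>m c. P (Poly_Mapping.single m c)" "\<And>f g. P f \<Longrightarrow> P g \<Longrightarrow> P (f + g)"
  shows "P f"
proof -
  have "P (\<Sum>m\<in>M. Poly_Mapping.single m (Poly_Mapping.lookup f m))" if "finite M" for M
    using that by induction (auto intro: assms)
  from this[of "Poly_Mapping.keys f"] show ?thesis
    by (simp add: mpoly_sum_single)
qed

lemma prod_pvar_power:
  fixes m :: "'v::finite \<Rightarrow>\<^sub>0 nat"
  shows "(\<Prod>v\<in>UNIV. (pvar v :: ('v, 'k::comm_ring_1) mpoly) ^ Poly_Mapping.lookup m v) = Poly_Mapping.single m 1"
proof -
  have pow: "(pvar v :: ('v, 'k) mpoly) ^ n = Poly_Mapping.single (Poly_Mapping.single v n) 1" for v n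
    by (induction n) (simp_all add: pvar_def mult_single single_add[symmetric])
  have "(\<Prod>v\<in>A. Poly_Mapping.single (g v) (1::'k)) = Poly_Mapping.single (\<Sum>v\<in>A. g v) 1"
    if "finite A" for A :: "'v set" and g :: "'v \<Rightarrow> 'v \<Rightarrow>\<^sub>0 nat"
    using that by induction (simp_all add: mult_single)
  moreover have "(\<Sum>v\<in>UNIV. Poly_Mapping.single v (Poly_Mapping.lookup m v)) = m"
    by (rule poly_mapping_eqI) (simp add: lookup_sum lookup_single when_def)
  ultimately show ?thesis
    by (simp add: pow)
qed

lemma single_eq_pconst_times:
  "Poly_Mapping.single m c = pconst c * (\<Prod>v\<in>UNIV. (pvar v :: ('v::finite, 'k::comm_ring_1) mpoly) ^ Poly_Mapping.lookup m v)"
  by (simp add: prod_pvar_power pconst_def mult_single)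

lemma
  fixes c :: "'k::comm_ring_1 \<Rightarrow> 'r::comm_ring_1" and h :: "'v::finite \<Rightarrow> 'r"
  assumes "rhom c"
  shows rhom_peval: "rhom (peval c h)"
    and peval_pconst: "peval c h (pconst a) = c a"
    and peval_pvar: "peval c h (pvar v) = h v"
proof -
  interpret c: rhom c by fact
  define mon where "mon m = (\<Prod>v\<in>UNIV. h v ^ Poly_Mapping.lookup m v)" for m :: "'v \<Rightarrow>\<^sub>0 nat"
  have mon_add: "mon (m + n) = mon m * mon n" for m n
    by (simp add: mon_def lookup_add power_add prod.distrib)
  have mon_0: "mon 0 = 1"
    by (simp add: mon_def)
  \<comment> \<open>Vanishing coefficients contribute nothing, so \<open>f\<close>, \<open>g\<close>
    and \<open>f + g\<close> can be summed over one common index set.\<close>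
  have sup: "peval c h f = (\<Sum>m\<in>A. c (Poly_Mapping.lookup f m) * mon m)"
    if "finite A" "Poly_Mapping.keys f \<subseteq> A" for f A
    unfolding peval_def mon_def
    by (rule sum.mono_neutral_left[OF that]) (simp add: in_keys_iff c.zero)
  have ev0: "peval c h 0 = 0"
    by (simp add: peval_def)
  have evs: "peval c h (Poly_Mapping.single m a) = c a * mon m" for m a
    by (subst sup[of "{m}"]) simp_all
  have ev_add: "peval c h (f + g) = peval c h f + peval c h g" for f g
  proof -
    let ?A = "Poly_Mapping.keys f \<union> Poly_Mapping.keys g"
    have "Poly_Mapping.keys (f + g) \<subseteq> ?A"
      by (rule Poly_Mapping.keys_add)
    then have "peval c h (f + g) = (\<Sum>m\<in>?A. c (Poly_Mapping.lookup (f + g) m) * mon m)"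
      by (intro sup) simp_all
    also have "\<dots> = (\<Sum>m\<in>?A. c (Poly_Mapping.lookup f m) * mon m) + (\<Sum>m\<in>?A. c (Poly_Mapping.lookup g m) * mon m)"
      by (simp add: lookup_add c.add distrib_right sum.distrib)
    finally show ?thesis
      by (simp add: sup[of ?A])
  qed
  have ev_mult: "peval c h (f * g) = peval c h f * peval c h g" for f g
  proof (induction f rule: mpoly_induct)
    case (single m a)
    show ?case
      by (induction g rule: mpoly_induct)
         (simp_all add: ev0 evs ev_add mult_single mon_add c.mult algebra_simps)
  qed (simp_all add: ev0 ev_add distrib_right)
  show "rhom (peval c h)"
    by unfold_locales (simp_all add: ev_add ev_mult evs mon_0 c.one flip: single_one)
  show "peval c h (pconst a) = c a"
    by (simp add: pconst_def evs mon_0)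
  have "mon (Poly_Mapping.single v 1) = (\<Prod>w\<in>UNIV. if w = v then h w else 1)"
    unfolding mon_def by (rule prod.cong) (simp_all add: lookup_single when_def)
  then show "peval c h (pvar v) = h v"
    by (simp add: pvar_def evs c.one)
qed

lemma rhom_psubst: "rhom (psubst h)"
  by (simp add: psubst_eq_peval rhom_peval rhom_pconst)

lemma psubst_pconst [simp]: "psubst h (pconst c) = pconst c"
  by (simp add: psubst_eq_peval peval_pconst rhom_pconst)

lemma psubst_pvar [simp]: "psubst h (pvar v) = h v"
  by (simp add: psubst_eq_peval peval_pvar rhom_pconst)

section \<open>Generated subalgebras\<close>

lemma alg_gen_0: "0 \<in> alg_gen A" and alg_gen_1: "1 \<in> alg_gen A"
  using alg_gen.const[of 0 A] alg_gen.const[of 1 A] by simp_all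

lemma alg_gen_power: "f \<in> alg_gen A \<Longrightarrow> f ^ n \<in> alg_gen A"
  by (induction n) (simp_all add: alg_gen_1 alg_gen.mult)

lemma alg_gen_sum: "(\<And>i. i \<in> I \<Longrightarrow> f i \<in> alg_gen A) \<Longrightarrow> (\<Sum>i\<in>I. f i) \<in> alg_gen A"
  by (induction I rule: infinite_finite_induct) (auto simp: alg_gen_0 intro: alg_gen.add)

lemma alg_gen_prod: "(\<And>i. i \<in> I \<Longrightarrow> f i \<in> alg_gen A) \<Longrightarrow> (\<Prod>i\<in>I. f i) \<in> alg_gen A"
  by (induction I rule: infinite_finite_induct) (auto simp: alg_gen_1 intro: alg_gen.mult)

lemma alg_gen_least: "A \<subseteq> alg_gen B \<Longrightarrow> f \<in> alg_gen A \<Longrightarrow> f \<in> alg_gen B"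
  by (rotate_tac, induction rule: alg_gen.induct) (auto intro: alg_gen.intros)

lemma alg_gen_pvar: "(f :: ('v::finite, 'k::comm_ring_1) mpoly) \<in> alg_gen (range pvar)"
  by (induction f rule: mpoly_induct)
     (auto simp: single_eq_pconst_times alg_gen_0 intro!: alg_gen_prod
        intro: alg_gen.mult alg_gen.add alg_gen.const alg_gen_power alg_gen.gen)

lemma alg_gen_fixed:
  assumes "rhom \<phi>" "\<And>c. \<phi> (pconst c) = pconst c" "\<And>a. a \<in> A \<Longrightarrow> \<phi> a = a" "f \<in> alg_gen A"
  shows "\<phi> f = f"
  using assms(4) by induction (simp_all add: assms(2,3) rhom.add[OF assms(1)] rhom.mult[OF assms(1)])

lemma rhom_eqI:
  fixes \<phi> \<psi> :: "('v::finite, 'k::comm_ring_1) mpoly \<Rightarrow> 'r::comm_ring_1"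
  assumes "rhom \<phi>" "rhom \<psi>" "\<And>c. \<phi> (pconst c) = \<psi> (pconst c)" "\<And>v. \<phi> (pvar v) = \<psi> (pvar v)"
  shows "\<phi> = \<psi>"
proof
  fix f
  show "\<phi> f = \<psi> f"
    using alg_gen_pvar[of f]
    by induction (auto simp: assms rhom.add[OF assms(1)] rhom.mult[OF assms(1)]
        rhom.add[OF assms(2)] rhom.mult[OF assms(2)])
qed

section \<open>Homogeneous components\<close>

lemma mdegree_add: "mdegree (m + n) = mdegree m + mdegree n"
  by (simp add: mdegree_def lookup_add sum.distrib)

lemma mdegree_0 [simp]: "mdegree 0 = 0"
  by (simp add: mdegree_def)

lemma graded_piece_iff: "f \<in> graded_piece d \<longleftrightarrow> (\<forall>m. Poly_Mapping.lookup f m \<noteq> 0 \<longrightarrow> mdegree m = d)"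
  by (auto simp: graded_piece_def in_keys_iff)

lemma graded_piece_0 [simp]: "0 \<in> graded_piece d"
  by (simp add: graded_piece_def)

lemma graded_piece_add: "f \<in> graded_piece d \<Longrightarrow> g \<in> graded_piece d \<Longrightarrow> f + g \<in> graded_piece d"
  unfolding graded_piece_iff lookup_add by (metis add_0)

lemma graded_piece_sum: "(\<And>i. i \<in> I \<Longrightarrow> f i \<in> graded_piece d) \<Longrightarrow> (\<Sum>i\<in>I. f i) \<in> graded_piece d"
  by (induction I rule: infinite_finite_induct) (auto intro: graded_piece_add)

lemma graded_piece_mult:
  assumes "f \<in> graded_piece d" "g \<in> graded_piece e"
  shows "f * g \<in> graded_piece (d + e)"
  using assms keys_mult[of f g] unfolding graded_piece_def by (force simp: mdegree_add)

lemma graded_piece_pconst [simp]: "pconst c \<in> graded_piece 0"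
  by (auto simp: graded_piece_def pconst_def)

lemma graded_piece_pvar [simp]: "pvar v \<in> graded_piece 1"
proof -
  have "mdegree (Poly_Mapping.single v 1) = (\<Sum>w\<in>UNIV. if w = v then 1 else 0)"
    unfolding mdegree_def by (rule sum.cong) (simp_all add: lookup_single when_def)
  then show ?thesis
    by (auto simp: graded_piece_def pvar_def)
qed

lemma graded_piece_one [simp]: "1 \<in> graded_piece 0"
  using graded_piece_pconst[of 1] by simp

lemma graded_piece_power: "f \<in> graded_piece d \<Longrightarrow> f ^ n \<in> graded_piece (n * d)"
  by (induction n) (auto dest: graded_piece_mult)

lemma graded_piece_prod:
  "(\<And>i. i \<in> I \<Longrightarrow> f i \<in> graded_piece (d i)) \<Longrightarrow> (\<Prod>i\<in>I. f i) \<in> graded_piece (\<Sum>i\<in>I. d i)"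
  by (induction I rule: infinite_finite_induct) (auto intro: graded_piece_mult)

lemma psubst_graded_piece:
  assumes h: "\<And>v. h v \<in> graded_piece 1" and f: "f \<in> graded_piece d"
  shows "psubst h f \<in> graded_piece d"
  unfolding psubst_def
proof (rule graded_piece_sum)
  fix m assume "m \<in> Poly_Mapping.keys f"
  then have "mdegree m = d"
    using f by (auto simp: graded_piece_def)
  moreover have "(\<Prod>v\<in>UNIV. h v ^ Poly_Mapping.lookup m v) \<in> graded_piece (\<Sum>v\<in>UNIV. Poly_Mapping.lookup m v * 1)"
    by (intro graded_piece_prod graded_piece_power h)
  ultimately show "pconst (Poly_Mapping.lookup f m) * (\<Prod>v\<in>UNIV. h v ^ Poly_Mapping.lookup m v) \<in> graded_piece d"
    using graded_piece_mult[OF graded_piece_pconst, of _ d] by (simp add: mdegree_def)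
qed

definition hcomp :: "nat \<Rightarrow> ('v::finite, 'k::comm_ring_1) mpoly \<Rightarrow> ('v, 'k) mpoly" where
  "hcomp d f = (\<Sum>m\<in>{m\<in>Poly_Mapping.keys f. mdegree m = d}. Poly_Mapping.single m (Poly_Mapping.lookup f m))"

lemma lookup_hcomp: "Poly_Mapping.lookup (hcomp d f) m = (if mdegree m = d then Poly_Mapping.lookup f m else 0)"
  by (auto simp: hcomp_def lookup_sum lookup_single when_def in_keys_iff)

lemma hcomp_graded_piece [simp]: "hcomp d f \<in> graded_piece d"
  by (auto simp: graded_piece_iff lookup_hcomp)

lemma hcomp_0 [simp]: "hcomp d 0 = 0"
  by (simp add: hcomp_def)

lemma hcomp_add: "hcomp d (f + g) = hcomp d f + hcomp d g"
  by (rule poly_mapping_eqI) (simp add: lookup_hcomp lookup_add)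

lemma hcomp_sum: "hcomp d (\<Sum>i\<in>I. f i) = (\<Sum>i\<in>I. hcomp d (f i))"
  by (induction I rule: infinite_finite_induct) (simp_all add: hcomp_add)

lemma hcomp_of_graded_piece: "f \<in> graded_piece e \<Longrightarrow> hcomp d f = (if d = e then f else 0)"
  by (rule poly_mapping_eqI) (auto simp: lookup_hcomp graded_piece_iff)

lemma hcomp_mult: "hcomp d (f * g) = (\<Sum>i\<le>d. hcomp i f * hcomp (d - i) g)"
proof (induction f rule: mpoly_induct)
  case (single m a)
  show ?case
  proof (induction g rule: mpoly_induct)
    case (single n b)
    have hs: "hcomp e (Poly_Mapping.single l c) = (if e = mdegree l then Poly_Mapping.single l c else 0)"
      for e c and l :: "'a \<Rightarrow>\<^sub>0 nat"
      by (rule hcomp_of_graded_piece) (auto simp: graded_piece_iff lookup_single when_def)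
    have "(\<Sum>i\<le>d. hcomp i (Poly_Mapping.single m a) * hcomp (d - i) (Poly_Mapping.single n b))
        = (\<Sum>i\<le>d. if i = mdegree m then (if d - i = mdegree n then Poly_Mapping.single (m + n) (a * b) else 0) else 0)"
      by (rule sum.cong) (simp_all add: hs mult_single)
    also have "\<dots> = hcomp d (Poly_Mapping.single m a * Poly_Mapping.single n b)"
      by (auto simp: mult_single hs mdegree_add)
    finally show ?case ..
  qed (simp_all add: distrib_left hcomp_add sum.distrib)
qed (simp_all add: distrib_right hcomp_add sum.distrib)

lemma hcomp_0_eq_pconst: "hcomp 0 f = pconst (Poly_Mapping.lookup f 0)"
proof (rule poly_mapping_eqI)
  fix m :: "'a \<Rightarrow>\<^sub>0 nat"
  have "mdegree m = 0 \<longleftrightarrow> m = 0"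
    by (auto simp: mdegree_def intro: poly_mapping_eqI)
  then show "Poly_Mapping.lookup (hcomp 0 f) m = Poly_Mapping.lookup (pconst (Poly_Mapping.lookup f 0)) m"
    by (auto simp: lookup_hcomp pconst_def lookup_single when_def)
qed

lemma sum_hcomp: "\<exists>n. f = (\<Sum>d\<le>n. hcomp d f)"
proof
  let ?n = "Max (insert 0 (mdegree ` Poly_Mapping.keys f))"
  show "f = (\<Sum>d\<le>?n. hcomp d f)"
  proof (rule poly_mapping_eqI)
    fix m
    show "Poly_Mapping.lookup f m = Poly_Mapping.lookup (\<Sum>d\<le>?n. hcomp d f) m"
      by (cases "m \<in> Poly_Mapping.keys f")
         (auto simp: lookup_sum lookup_hcomp in_keys_iff)
  qed
qed

text \<open>Each component of \<open>f\<close> keeps its degree under \<phi>, so only one term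
  survives. Consequently the components of an invariant are invariant.\<close>

lemma hcomp_graded_hom:
  assumes "\<phi> \<in> graded_alg_auts"
  shows "hcomp d (\<phi> f) = \<phi> (hcomp d f)"
proof -
  have add: "\<phi> (f + g) = \<phi> f + \<phi> g" and gr: "f \<in> graded_piece e \<Longrightarrow> \<phi> f \<in> graded_piece e" for f g e
    using assms unfolding graded_alg_auts_def by blast+
  have \<phi>0: "\<phi> 0 = 0"
    using add[of 0 0] by simp
  have \<phi>sum: "\<phi> (\<Sum>i\<in>I. h i) = (\<Sum>i\<in>I. \<phi> (h i))" for I and h :: "nat \<Rightarrow> _"
    by (induction I rule: infinite_finite_induct) (simp_all add: \<phi>0 add)
  obtain n where n: "f = (\<Sum>e\<le>n. hcomp e f)"
    using sum_hcomp by blast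
  have "hcomp d (\<phi> f) = (\<Sum>e\<le>n. hcomp d (\<phi> (hcomp e f)))"
    by (subst n) (simp add: \<phi>sum hcomp_sum)
  also have "\<dots> = (\<Sum>e\<le>n. \<phi> (hcomp d (hcomp e f)))"
    by (intro sum.cong refl) (simp add: hcomp_of_graded_piece[OF gr[OF hcomp_graded_piece]]
        hcomp_of_graded_piece[OF hcomp_graded_piece] \<phi>0)
  also have "\<dots> = \<phi> (hcomp d f)"
    by (subst (2) n) (simp add: \<phi>sum hcomp_sum)
  finally show ?thesis .
qed

section \<open>The fundamental invariants\<close>

text \<open>Formulated over any commutative ring so that one normalization serves both the scalar
  \<alpha> in the field and the constant polynomial \<open>pconst \<alpha>\<close>.\<close>

locale char2_cubic =
  fixes a :: "'a::comm_ring_1"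
  assumes two: "2 = (0::'a)" and cubic: "a ^ 3 = a + 1"
begin

lemma add_self: "x + x = (0::'a)"
  by (metis mult_2 mult_zero_left two)

lemma add_self_left: "x + (x + y) = (y::'a)"
  by (metis add.assoc add_0 add_self)

lemma add_eq_0D: "x + y = 0 \<Longrightarrow> x = (y::'a)"
  using add_self_left[of x y] by simp

lemma cube: "a * (a * a) = a + 1"
  using cubic by (simp add: power3_eq_cube mult.assoc)

lemma cube_left: "a * (a * (a * y)) = a * y + y"
  by (metis cube mult.assoc distrib_right mult_1)

text \<open>Simplification with these rules expands everything and cancels coefficients modulo 2 and modulo
  \<open>a^3 = a + 1\<close>; it decides the identities between the invariants below.\<close>

lemmas char2_norm = power_numeral_reduce ring_distribs mult.assoc mult.commute mult.left_commute
  add.assoc add.commute add.left_commute add_self add_self_left cube cube_left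

end

text \<open>\<open>inv_f\<close> and \<open>inv_g\<close> are the solutions of the linear system expressing invariance of
  \<open>y_i^4\<close> plus terms of degree at most 2 in \<open>y1, y2\<close> that are additive in \<open>y1, y2\<close>; similarly \<open>inv_h\<close>
  solves it, up to a factor, for additive polynomials of degree 2 in \<open>y1, y2\<close>.\<close>

definition inv_f :: "'a::comm_ring_1 \<Rightarrow> 'a \<Rightarrow> 'a \<Rightarrow> 'a \<Rightarrow> 'a \<Rightarrow> 'a" where
  "inv_f a x1 x2 y1 y2 = y1^4 + a^3*x1^2*y1^2 + a^2*x1*x2*y2^2
     + (a*x1^3 + a^3*x2^3)*y1 + a^5*x1*x2^2*y2"

definition inv_g :: "'a::comm_ring_1 \<Rightarrow> 'a \<Rightarrow> 'a \<Rightarrow> 'a \<Rightarrow> 'a \<Rightarrow> 'a" where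
  "inv_g a x1 x2 y1 y2 = y2^4 + (x1*x2 + a^3*x2^2)*y1^2 + (a^3*x1*x2 + a^6*x2^2)*y2^2
     + a^4*x2^3*y1 + (x1^3 + a^3*x1^2*x2 + a^6*x1*x2^2 + a^2*x2^3)*y2"

definition inv_h :: "'a::comm_ring_1 \<Rightarrow> 'a \<Rightarrow> 'a \<Rightarrow> 'a \<Rightarrow> 'a \<Rightarrow> 'a" where
  "inv_h a x1 x2 y1 y2 = x2*(x1^3 + a^3*x1^2*x2 + a^2*x2^3)*y1^2 + x1*(x1^3 + a^2*x2^3)*y2^2
     + (a*x1^3*x2^2 + a^3*x2^5)*y1 + (x1^5 + a^2*x1^2*x2^3 + a^5*x1*x2^4)*y2"

lemmas inv_fgh_defs = inv_f_def inv_g_def inv_h_def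

lemma (in rhom) inv_fgh:
  "\<phi> (inv_f a x1 x2 y1 y2) = inv_f (\<phi> a) (\<phi> x1) (\<phi> x2) (\<phi> y1) (\<phi> y2)"
  "\<phi> (inv_g a x1 x2 y1 y2) = inv_g (\<phi> a) (\<phi> x1) (\<phi> x2) (\<phi> y1) (\<phi> y2)"
  "\<phi> (inv_h a x1 x2 y1 y2) = inv_h (\<phi> a) (\<phi> x1) (\<phi> x2) (\<phi> y1) (\<phi> y2)"
  by (simp_all add: inv_fgh_defs add mult power)

context char2_cubic
begin

lemma inv_fgh_sigma:
  "inv_f a x1 x2 (y1 + x1) (y2 + x2) = inv_f a x1 x2 y1 y2"
  "inv_g a x1 x2 (y1 + x1) (y2 + x2) = inv_g a x1 x2 y1 y2"
  "inv_h a x1 x2 (y1 + x1) (y2 + x2) = inv_h a x1 x2 y1 y2"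
  by (simp_all add: inv_fgh_defs char2_norm)

lemma inv_fgh_tau:
  "inv_f a x1 x2 (y1 + a*x2) (y2 + x1) = inv_f a x1 x2 y1 y2"
  "inv_g a x1 x2 (y1 + a*x2) (y2 + x1) = inv_g a x1 x2 y1 y2"
  "inv_h a x1 x2 (y1 + a*x2) (y2 + x1) = inv_h a x1 x2 y1 y2"
  by (simp_all add: inv_fgh_defs char2_norm)

lemma inv_fgh_rho:
  "inv_f a x1 x2 (y1 + a^2*x1) (y2 + (a + a^2)*x2) = inv_f a x1 x2 y1 y2"
  "inv_g a x1 x2 (y1 + a^2*x1) (y2 + (a + a^2)*x2) = inv_g a x1 x2 y1 y2"
  "inv_h a x1 x2 (y1 + a^2*x1) (y2 + (a + a^2)*x2) = inv_h a x1 x2 y1 y2"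
  by (simp_all add: inv_fgh_defs char2_norm)

text \<open>Squaring is additive in characteristic 2, so \<open>h^2\<close> is again additive in
  \<open>y1\<close>, \<open>y2\<close>. Subtracting multiples of \<open>f\<close> and
  \<open>g\<close> removes the fourth powers; what remains is an invariant additive polynomial of
  degree 2, hence a multiple of \<open>h\<close>.\<close>

lemma inv_h_square:
  "inv_h a x1 x2 y1 y2 * inv_h a x1 x2 y1 y2 =
     (x2*(x1^3 + a^3*x1^2*x2 + a^2*x2^3))^2 * inv_f a x1 x2 y1 y2
     + (x1*(x1^3 + a^2*x2^3))^2 * inv_g a x1 x2 y1 y2
     + (x1^6 + a^3*x1^5*x2 + a^6*x1^4*x2^2 + a^5*x1^2*x2^4 + a^4*x2^6) * inv_h a x1 x2 y1 y2"
  by (simp add: inv_fgh_defs char2_norm)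

text \<open>All elements here are additive in \<open>y1\<close>, \<open>y2\<close>, and the
  right-hand sides come from dividing by \<open>f\<close>, \<open>g\<close>, \<open>h\<close>:
  \<open>f^2\<close> cancels \<open>y1^8\<close>, then \<open>f\<close> and \<open>g\<close> cancel
  \<open>y1^4\<close> and \<open>y2^4\<close>, and the quadratic remainder is a multiple of
  \<open>h\<close>. The left-hand sides are what the elimination of the three involutions leaves
  over.\<close>

lemma last_step_generators:
  fixes x1 x2 y1 y2 :: 'a
  defines "N \<equiv> y1^2 + x1*y1"
  defines "N' \<equiv> N^2 + a*x1^2*N" and "z' \<equiv> x1*(x1*y2 + x2*y1) + x2*N"
  defines "t \<equiv> (x1^2 + a^6*x2^2)*z' + a^4*x2*N'"
  shows "(x1^3 + a^2*x2^3)*N' + (a^4*x2^4 + a^5*x1^2*x2^2 + a^2*x1^3*x2)*z'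
      = (x1^3 + a^2*x2^3)*inv_f a x1 x2 y1 y2 + a^2*x2*inv_h a x1 x2 y1 y2"
    and "t^2 + x1^5*t = (a^4*x2*inv_f a x1 x2 y1 y2)^2
      + (a^4*x1^5*x2 + x1^4*x2^2 + a^5*x2^6)*inv_f a x1 x2 y1 y2
      + a^5*x1^2*x2^4*inv_g a x1 x2 y1 y2
      + (x1^4 + a^6*x1^2*x2^2 + a^5*x2^4)*inv_h a x1 x2 y1 y2"
  by (simp_all add: assms inv_fgh_defs char2_norm)

end

section \<open>Descent along involutions\<close>

text \<open>Because \<open>t*t\<close> reduces to \<open>P + Q*t\<close>, the polynomials having
  some multiple by a power of \<open>s\<close> of this form are closed under sums and products, so
  it suffices to check \<open>U\<close>. Carrying the exponent \<open>n\<close> replaces working in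
  a localization. In a chain of such steps, \<open>U\<close> is the set \<open>A\<close> of the step
  before.\<close>

lemma quadratic_descent:
  fixes F s t :: "('v::{finite,linorder}, 'k::field) mpoly"
  assumes s: "s \<in> alg_gen A"
    and t: "\<exists>P\<in>alg_gen A. \<exists>Q\<in>alg_gen A. t * t = P + Q * t"
    and U: "\<And>r. r \<in> U \<Longrightarrow> \<exists>n. \<exists>P\<in>alg_gen A. \<exists>Q\<in>alg_gen A. s ^ n * r = P + Q * t"
    and \<phi>: "rhom \<phi>" "\<And>c. \<phi> (pconst c) = pconst c" "\<And>r. r \<in> A \<Longrightarrow> \<phi> r = r" "\<phi> t \<noteq> t"
    and F: "F \<in> alg_gen U" "\<phi> F = F"
  shows "\<exists>n. s ^ n * F \<in> alg_gen A"
proof -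
  interpret \<phi>: rhom \<phi> by fact
  have fixed: "\<phi> r = r" if "r \<in> alg_gen A" for r
    using alg_gen_fixed[OF \<phi>(1-3) that] by simp
  have "\<exists>n. \<exists>P\<in>alg_gen A. \<exists>Q\<in>alg_gen A. s ^ n * F = P + Q * t"
    using F(1)
  proof induction
    case (const c)
    have "s ^ 0 * pconst c = pconst c + 0 * t" by simp
    then show ?case
      using alg_gen.const alg_gen_0 by blast
  next
    case (gen r)
    then show ?case by (rule U)
  next
    case (add f g)
    then obtain m P Q n P' Q' where PQ: "P \<in> alg_gen A" "Q \<in> alg_gen A" "P' \<in> alg_gen A" "Q' \<in> alg_gen A"
      and eq: "s ^ m * f = P + Q * t" "s ^ n * g = P' + Q' * t"
      by blast
    have "s ^ (m + n) * (f + g) = s ^ n * (s ^ m * f) + s ^ m * (s ^ n * g)"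
      by (simp add: power_add algebra_simps)
    also have "\<dots> = (s ^ n * P + s ^ m * P') + (s ^ n * Q + s ^ m * Q') * t"
      unfolding eq by (simp add: algebra_simps)
    finally have "s ^ (m + n) * (f + g) = (s ^ n * P + s ^ m * P') + (s ^ n * Q + s ^ m * Q') * t" .
    moreover have "s ^ n * P + s ^ m * P' \<in> alg_gen A" "s ^ n * Q + s ^ m * Q' \<in> alg_gen A"
      using PQ s by (auto intro!: alg_gen.add alg_gen.mult alg_gen_power)
    ultimately show ?case
      by blast
  next
    case (mult f g)
    then obtain m P Q n P' Q' where PQ: "P \<in> alg_gen A" "Q \<in> alg_gen A" "P' \<in> alg_gen A" "Q' \<in> alg_gen A"
      and eq: "s ^ m * f = P + Q * t" "s ^ n * g = P' + Q' * t"
      by blast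
    obtain P0 Q0 where t: "P0 \<in> alg_gen A" "Q0 \<in> alg_gen A" "t * t = P0 + Q0 * t"
      using t by blast
    have "s ^ (m + n) * (f * g) = (s ^ m * f) * (s ^ n * g)"
      by (simp add: power_add algebra_simps)
    also have "\<dots> = P * P' + (P * Q' + P' * Q) * t + Q * Q' * (t * t)"
      unfolding eq by (simp add: algebra_simps)
    also have "\<dots> = (P * P' + Q * Q' * P0) + (P * Q' + P' * Q + Q * Q' * Q0) * t"
      unfolding t(3) by (simp add: algebra_simps)
    finally have "s ^ (m + n) * (f * g) = (P * P' + Q * Q' * P0) + (P * Q' + P' * Q + Q * Q' * Q0) * t" .
    moreover have "P * P' + Q * Q' * P0 \<in> alg_gen A" "P * Q' + P' * Q + Q * Q' * Q0 \<in> alg_gen A"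
      using PQ t by (auto intro!: alg_gen.add alg_gen.mult)
    ultimately show ?case
      by blast
  qed
  then obtain n P Q where PQ: "P \<in> alg_gen A" "Q \<in> alg_gen A" and eq: "s ^ n * F = P + Q * t"
    by blast
  have "P + Q * \<phi> t = \<phi> (P + Q * t)"
    by (simp add: \<phi>.add \<phi>.mult fixed PQ)
  also have "\<dots> = P + Q * t"
    by (simp add: \<phi>.mult \<phi>.power fixed s F(2) flip: eq)
  finally have "Q * (\<phi> t - t) = 0"
    by (simp add: algebra_simps)
  then have "Q = 0"
    using \<phi>(4) by simp
  with eq PQ show ?thesis
    by auto
qed

section \<open>Reduction modulo a linear form\<close>

text \<open>Nesting this three times evaluates a polynomial in three variables, encoded as
  \<open>poly poly poly\<close>; this encoding gives access to \<open>degree\<close> and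
  \<open>pcompose\<close>.\<close>

definition pev :: "('a::comm_ring_1 \<Rightarrow> 'b::comm_ring_1) \<Rightarrow> 'b \<Rightarrow> 'a poly \<Rightarrow> 'b" where
  "pev c x p = poly (map_poly c p) x"

context
  fixes c :: "'a::comm_ring_1 \<Rightarrow> 'b::comm_ring_1" and x :: 'b
  assumes c: "rhom c"
begin

interpretation c: rhom c by fact

lemma pev_0: "pev c x 0 = 0"
  by (simp add: pev_def)

lemma pev_pCons: "pev c x (pCons a p) = c a + x * pev c x p"
  by (simp add: pev_def map_poly_pCons c.zero)

lemma rhom_pev: "rhom (pev c x)"
proof
  show add: "pev c x (p + q) = pev c x p + pev c x q" for p q
    by (induction p q rule: poly_induct2) (simp_all add: pev_0 pev_pCons c.add algebra_simps)
  have smult: "pev c x (smult a q) = c a * pev c x q" for a q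
    by (induction q) (simp_all add: pev_0 pev_pCons c.mult algebra_simps)
  show "pev c x (p * q) = pev c x p * pev c x q" for p q
    by (induction p) (simp_all add: pev_0 pev_pCons add smult c.zero algebra_simps)
  show "pev c x 1 = 1"
    by (simp add: one_pCons pev_pCons pev_0 c.one)
qed

end

lemma rhom_pev_comp:
  assumes "rhom \<phi>" "rhom c"
  shows "\<phi> (pev c x p) = pev (\<lambda>a. \<phi> (c a)) (\<phi> x) p"
proof -
  note rules = pev_0[OF assms(2)] pev_pCons[OF assms(2)] pev_0[OF rhom_comp[OF assms]]
    pev_pCons[OF rhom_comp[OF assms]] rhom.add[OF assms(1)] rhom.mult[OF assms(1)] rhom.zero[OF assms(1)]
  show ?thesis
    by (induction p) (simp_all add: rules)
qed

lemma rhom_const_poly: "rhom (\<lambda>a::'a::comm_ring_1. [:a:])"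
  by unfold_locales (simp_all add: one_pCons)

lemma pev_const_poly: "pev (\<lambda>a. [:h a:]) q p = pcompose (map_poly h p) q" if "rhom h" for h :: "'a::comm_ring_1 \<Rightarrow> 'b::comm_ring_1"
proof -
  have "rhom (\<lambda>a. [:h a:])"
    by (rule rhom_comp[OF rhom_const_poly that])
  note rules = pev_0[OF this] pev_pCons[OF this]
  show ?thesis
    by (induction p) (simp_all add: rules map_poly_pCons pcompose_pCons rhom.zero[OF that])
qed

lemma pev_const_poly_id: "pev (\<lambda>a::'a::comm_ring_1. [:a:]) q p = pcompose p q"
  by (induction p) (simp_all add: pev_0[OF rhom_const_poly] pev_pCons[OF rhom_const_poly] pcompose_pCons)

lemma rhom_pcompose: "rhom (\<lambda>p::'a::comm_ring_1 poly. pcompose p q)"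
  by unfold_locales (simp_all add: pcompose_add pcompose_mult pcompose_1)

text \<open>The target is read as k[x2][y1][y2]. The innermost variable of \<open>E\<close> goes to
  \<open>x2\<close>, the middle one to \<open>f\<close>, which is free of \<open>y2\<close>, and the
  outer one to \<open>g\<close>. Evaluation thus splits into composing every coefficient with
  \<open>f\<close> and the result with \<open>g\<close>.\<close>

lemma pev_tower:
  fixes E :: "'k::comm_ring_1 poly poly poly"
  shows "pev (pev (pev (\<lambda>c. [:[:[:c:]:]:]) [:[:[:0, 1:]:]:]) [:f:]) g E
    = pcompose (map_poly (\<lambda>e. pcompose e f) E) g"
proof -
  note c = rhom_const_poly and cc = rhom_comp[OF rhom_const_poly rhom_const_poly]
  have "pev (\<lambda>c::'k. [:[:[:c:]:]:]) [:[:[:0, 1:]:]:] = (\<lambda>d. [:[:d:]:])"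
  proof (rule ext)
    fix d :: "'k poly"
    show "pev (\<lambda>c. [:[:[:c:]:]:]) [:[:[:0, 1:]:]:] d = [:[:d:]:]"
      using rhom_pev_comp[OF cc c, of "[:0, 1:]" d] by (simp add: pev_const_poly_id)
  qed
  moreover have "pev (\<lambda>d. [:[:d:]:]) [:f:] = (\<lambda>e. [:pcompose e f:])"
  proof (rule ext)
    fix e
    show "pev (\<lambda>d. [:[:d:]:]) [:f:] e = [:pcompose e f:]"
      using rhom_pev_comp[OF c c, of f e] by (simp add: pev_const_poly_id)
  qed
  moreover have "pev (\<lambda>e. [:pcompose e f:]) g E = pcompose (map_poly (\<lambda>e. pcompose e f) E) g"
    by (rule pev_const_poly[OF rhom_pcompose])
  ultimately show ?thesis
    by simp
qed

text \<open>Modulo \<open>x1\<close> the generators \<open>f\<close>, \<open>h\<close> have degrees 4 and 2 in \<open>y1\<close> and do not involve \<open>y2\<close>,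
  while \<open>g\<close> has degree 4 in \<open>y2\<close>; so \<open>1\<close> and \<open>h\<close> are independent because degrees
  in \<open>y1\<close> separate modulo 4.\<close>

lemma pcompose_independent:
  fixes E0 E1 :: "'a::idom poly poly"
  assumes f: "degree f = 4" and h: "degree h = 2" and g: "degree g > 0"
    and eq: "pcompose (map_poly (\<lambda>e. pcompose e f) E0) g + pcompose (map_poly (\<lambda>e. pcompose e f) E1) g * [:h:] = 0"
  shows "E0 = 0 \<and> E1 = 0"
proof -
  let ?m = "map_poly (\<lambda>e. pcompose e f)"
  have "pcompose (?m E0 + smult h (?m E1)) g = 0"
    using eq by (simp add: pcompose_add pcompose_smult mult.commute)
  \<comment> \<open>Composition with the nonconstant \<open>g\<close> is injective, which removes
    \<open>y2\<close> and leaves an equation to compare coefficient by coefficient.\<close>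
  then have sum: "?m E0 + smult h (?m E1) = 0"
    using g pcompose_eq_0 by blast
  have "coeff E0 n = 0 \<and> coeff E1 n = 0" for n
  proof -
    let ?e0 = "coeff E0 n" and ?e1 = "coeff E1 n"
    have e: "pcompose ?e0 f = - (h * pcompose ?e1 f)"
      using arg_cong[OF sum, of "\<lambda>p. coeff p n"] by (simp add: coeff_map_poly eq_neg_iff_add_eq_0)
    have "?e1 = 0"
    proof (rule ccontr)
      assume "?e1 \<noteq> 0"
      then have "pcompose ?e1 f \<noteq> 0"
        using f pcompose_eq_0[of ?e1 f] by auto
      moreover have "h \<noteq> 0"
        using h by auto
      ultimately have "degree (h * pcompose ?e1 f) = 2 + degree ?e1 * 4"
        by (simp add: degree_mult_eq degree_pcompose f h)
      moreover have "degree (h * pcompose ?e1 f) = degree ?e0 * 4"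
        using arg_cong[OF e, of degree] by (simp add: degree_pcompose f)
      ultimately show False
        by presburger
    qed
    with e show ?thesis
      using f pcompose_eq_0[of ?e0 f] by auto
  qed
  then show ?thesis
    by (simp add: poly_eq_iff)
qed


section \<open>The ring of invariants\<close>

locale counterexample =
  fixes \<alpha> :: "'k::field"
  assumes two_k: "2 = (0::'k)" and cubic_k: "\<alpha> ^ 3 = \<alpha> + 1"
begin

sublocale k: char2_cubic \<alpha>
  by unfold_locales (fact two_k cubic_k)+

sublocale S: char2_cubic "pconst \<alpha> :: (var, 'k) mpoly"
proof
  have "(2 :: (var, 'k) mpoly) = pconst (1 + 1)"
    unfolding pconst_add by simp
  then show "(2 :: (var, 'k) mpoly) = 0"
    by (simp add: two_k)
  show "(pconst \<alpha> :: (var, 'k) mpoly) ^ 3 = pconst \<alpha> + 1"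
    using cubic_k by (metis pconst_power pconst_add pconst_1)
qed

lemma \<alpha>_nonzero: "\<alpha> \<noteq> 0"
  using cubic_k by auto

abbreviation "a \<equiv> pconst \<alpha> :: (var, 'k) mpoly"
abbreviation "x1 \<equiv> pvar X1 :: (var, 'k) mpoly"
abbreviation "x2 \<equiv> pvar X2 :: (var, 'k) mpoly"
abbreviation "y1 \<equiv> pvar Y1 :: (var, 'k) mpoly"
abbreviation "y2 \<equiv> pvar Y2 :: (var, 'k) mpoly"
abbreviation "f \<equiv> inv_f a x1 x2 y1 y2"
abbreviation "g \<equiv> inv_g a x1 x2 y1 y2"
abbreviation "h \<equiv> inv_h a x1 x2 y1 y2"
abbreviation "B \<equiv> {x1, x2, f, g, h}"

lemma pvar_nonzero: "(pvar v :: (var, 'k) mpoly) \<noteq> 0"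
  unfolding pvar_def by (metis lookup_single_eq lookup_zero zero_neq_one)

lemma a_nonzero: "a \<noteq> 0"
  using \<alpha>_nonzero pconst_inject[of \<alpha> 0] by simp

lemma
  shows rhom_\<sigma>: "rhom (\<sigma> :: (var, 'k) mpoly \<Rightarrow> _)" and rhom_\<tau>: "rhom (\<tau> \<alpha>)" and rhom_\<rho>: "rhom (\<rho> \<alpha>)"
  by (simp_all add: \<sigma>_def \<tau>_def \<rho>_def rhom_psubst)

lemma \<sigma>_simps [simp]: "\<sigma> (pconst c) = pconst c" "\<sigma> x1 = x1" "\<sigma> x2 = x2" "\<sigma> y1 = y1 + x1" "\<sigma> y2 = y2 + x2"
  by (simp_all add: \<sigma>_def)

lemma \<tau>_simps [simp]: "\<tau> \<alpha> (pconst c) = pconst c" "\<tau> \<alpha> x1 = x1" "\<tau> \<alpha> x2 = x2"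
    "\<tau> \<alpha> y1 = y1 + a * x2" "\<tau> \<alpha> y2 = y2 + x1"
  by (simp_all add: \<tau>_def)

lemma \<rho>_simps [simp]: "\<rho> \<alpha> (pconst c) = pconst c" "\<rho> \<alpha> x1 = x1" "\<rho> \<alpha> x2 = x2"
    "\<rho> \<alpha> y1 = y1 + a^2 * x1" "\<rho> \<alpha> y2 = y2 + (a + a^2) * x2"
  by (simp_all add: \<rho>_def pconst_power pconst_add)

lemma B_fixed:
  assumes "r \<in> B"
  shows "\<sigma> r = r" "\<tau> \<alpha> r = r" "\<rho> \<alpha> r = r"
  using assms by (auto simp: rhom.inv_fgh[OF rhom_\<sigma>] rhom.inv_fgh[OF rhom_\<tau>] rhom.inv_fgh[OF rhom_\<rho>]
      S.inv_fgh_sigma S.inv_fgh_tau S.inv_fgh_rho)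

text \<open>\<open>\<sigma>\<close> and \<open>\<rho>\<close> go first because both move
  \<open>y1\<close> by a constant multiple of \<open>x1\<close>, so they bring in no other
  denominator. \<open>\<tau>\<close> moves \<open>y1\<close> by a multiple of \<open>x2\<close> and
  needs the special choice of \<open>t\<close>.\<close>

lemma invariants_localized:
  assumes inv: "\<sigma> F = F" "\<tau> \<alpha> F = F" "\<rho> \<alpha> F = F"
  shows "\<exists>n. x1 ^ n * F \<in> alg_gen B"
proof -
  note hom_simps = rhom.add[OF rhom_\<sigma>] rhom.mult[OF rhom_\<sigma>] rhom.power[OF rhom_\<sigma>]
    rhom.add[OF rhom_\<tau>] rhom.mult[OF rhom_\<tau>] rhom.power[OF rhom_\<tau>]
    rhom.add[OF rhom_\<rho>] rhom.mult[OF rhom_\<rho>] rhom.power[OF rhom_\<rho>]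
  \<comment> \<open>\<open>N\<close>, \<open>N'\<close> and \<open>T\<close> are the norms of
    \<open>y1\<close>, \<open>N\<close> and \<open>t\<close> under \<open>\<sigma>\<close>,
    \<open>\<rho>\<close> and \<open>\<tau>\<close>: products of the element with its shifted image.
    In \<open>z\<close>, \<open>z'\<close> and \<open>h'\<close> the shifts of two elements
    cancel.\<close>
  define N where "N = y1^2 + x1*y1"
  define z where "z = x1*y2 + x2*y1"
  define N' where "N' = N^2 + a*x1^2*N"
  define z' where "z' = x1*z + x2*N"
  \<comment> \<open>With \<open>u\<close>, \<open>w\<close> the shifts of \<open>z'\<close>,
    \<open>N'\<close> under \<open>\<tau>\<close>, the coefficients are a solution of
    \<open>(x1^2 + a^6*x2^2)*u + a^4*x2*w = x1^5\<close>, so that \<open>t\<close> is shifted by a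
    pure power of \<open>x1\<close>.\<close>
  define t where "t = (x1^2 + a^6*x2^2)*z' + a^4*x2*N'"
  define T where "T = t^2 + x1^5*t"
  define h' where "h' = (x1^3 + a^2*x2^3)*N' + (a^4*x2^4 + a^5*x1^2*x2^2 + a^2*x1^3*x2)*z'"
  note mem = alg_gen.add alg_gen.mult alg_gen_power alg_gen.const alg_gen_0 alg_gen_1
  let ?A1 = "{x1, x2, N, z}" and ?A2 = "{x1, x2, N', z'}" and ?A3 = "{x1, x2, T, h'}"
  have "\<exists>n. x1 ^ n * F \<in> alg_gen ?A1"
  proof (rule quadratic_descent[where t = y1 and U = "range pvar" and \<phi> = \<sigma>])
    show "\<exists>P\<in>alg_gen ?A1. \<exists>Q\<in>alg_gen ?A1. y1 * y1 = P + Q * y1"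
      by (rule bexI[of _ N], rule bexI[of _ x1]) (simp_all add: N_def S.char2_norm alg_gen.gen)
    fix r :: "(var, 'k) mpoly"
    show "\<sigma> r = r" if "r \<in> ?A1"
      using that by (auto simp: N_def z_def hom_simps S.char2_norm)
    assume "r \<in> range pvar"
    then obtain v where r: "r = pvar v" by blast
    show "\<exists>n. \<exists>P\<in>alg_gen ?A1. \<exists>Q\<in>alg_gen ?A1. x1 ^ n * r = P + Q * y1"
    proof (cases v)
      case Y1
      then show ?thesis
        by (intro exI[of _ 0] bexI[of _ 0] bexI[of _ 1]) (simp_all add: r mem)
    next
      case Y2
      have "x1 ^ 1 * r = z + x2 * y1"
        by (simp add: r Y2 z_def S.char2_norm)
      then show ?thesis
        by (intro exI[of _ 1] bexI[of _ z] bexI[of _ x2]) (simp_all add: alg_gen.gen)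
    qed (rule exI[of _ 0], rule bexI[of _ r], rule bexI[of _ 0], simp_all add: r mem alg_gen.gen)+
  qed (use inv pvar_nonzero in \<open>simp_all add: rhom_\<sigma> alg_gen_pvar alg_gen.gen\<close>)
  then obtain n1 where F1: "x1 ^ n1 * F \<in> alg_gen ?A1" by blast
  have "\<exists>n. x1 ^ n * (x1 ^ n1 * F) \<in> alg_gen ?A2"
  proof (rule quadratic_descent[where t = N and U = ?A1 and \<phi> = "\<rho> \<alpha>"])
    have eq: "N * N = N' + (a * x1^2) * N"
      by (simp add: N'_def S.char2_norm)
    show "\<exists>P\<in>alg_gen ?A2. \<exists>Q\<in>alg_gen ?A2. N * N = P + Q * N"
      by (rule bexI[of _ N'], rule bexI[of _ "a * x1^2"], rule eq)
        (auto intro!: mem intro: alg_gen.gen)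
    have "\<rho> \<alpha> N = N + a * x1^2"
      by (simp add: N_def hom_simps S.char2_norm)
    then show "\<rho> \<alpha> N \<noteq> N"
      using a_nonzero pvar_nonzero by simp
    fix r :: "(var, 'k) mpoly"
    show "\<rho> \<alpha> r = r" if "r \<in> ?A2"
      using that by (auto simp: N_def N'_def z_def z'_def hom_simps S.char2_norm)
    assume r: "r \<in> ?A1"
    show "\<exists>n. \<exists>P\<in>alg_gen ?A2. \<exists>Q\<in>alg_gen ?A2. x1 ^ n * r = P + Q * N"
    proof -
      consider "r \<in> {x1, x2}" | "r = N" | "r = z" using r by blast
      then show ?thesis
      proof cases
        case 1
        then show ?thesis
          by (intro exI[of _ 0] bexI[of _ r] bexI[of _ 0]) (auto simp: mem intro: alg_gen.gen)
      next
        case 2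
        then show ?thesis
          by (intro exI[of _ 0] bexI[of _ 0] bexI[of _ 1]) (simp_all add: mem)
      next
        case 3
        have "x1 ^ 1 * r = z' + x2 * N"
          by (simp add: 3 z'_def S.char2_norm)
        then show ?thesis
          by (intro exI[of _ 1] bexI[of _ z'] bexI[of _ x2]) (simp_all add: alg_gen.gen)
      qed
    qed
  qed (use inv F1 in \<open>simp_all add: rhom_\<rho> hom_simps alg_gen.gen\<close>)
  then obtain n2 where F2: "x1 ^ n2 * (x1 ^ n1 * F) \<in> alg_gen ?A2" by blast
  have "\<exists>n. x1 ^ n * (x1 ^ n2 * (x1 ^ n1 * F)) \<in> alg_gen ?A3"
  proof (rule quadratic_descent[where t = t and U = ?A2 and \<phi> = "\<tau> \<alpha>"])
    have eq: "t * t = T + x1^5 * t"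
      by (simp add: T_def S.char2_norm)
    show "\<exists>P\<in>alg_gen ?A3. \<exists>Q\<in>alg_gen ?A3. t * t = P + Q * t"
      by (rule bexI[of _ T], rule bexI[of _ "x1^5"], rule eq)
        (auto intro!: mem intro: alg_gen.gen)
    have \<tau>N: "\<tau> \<alpha> N' = N' + (a^4*x2^4 + a^5*x1^2*x2^2 + a^2*x1^3*x2)"
      by (simp add: N'_def N_def hom_simps S.char2_norm)
    have \<tau>z: "\<tau> \<alpha> z' = z' + (x1^3 + a^2*x2^3)"
      by (simp add: z'_def z_def N_def hom_simps S.char2_norm)
    have \<tau>t: "\<tau> \<alpha> t = t + x1^5"
      by (simp add: t_def hom_simps \<tau>N \<tau>z S.char2_norm)
    then show "\<tau> \<alpha> t \<noteq> t"
      using pvar_nonzero by simp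
    fix r :: "(var, 'k) mpoly"
    have "\<tau> \<alpha> T = T"
      by (simp add: T_def hom_simps \<tau>t S.char2_norm)
    moreover have "\<tau> \<alpha> h' = h'"
      by (simp add: h'_def hom_simps \<tau>N \<tau>z S.char2_norm)
    ultimately show "\<tau> \<alpha> r = r" if "r \<in> ?A3"
      using that by auto
    assume r: "r \<in> ?A2"
    show "\<exists>n. \<exists>P\<in>alg_gen ?A3. \<exists>Q\<in>alg_gen ?A3. x1 ^ n * r = P + Q * t"
    proof -
      consider "r \<in> {x1, x2}" | "r = N'" | "r = z'" using r by blast
      then show ?thesis
      proof cases
        case 1
        then show ?thesis
          by (intro exI[of _ 0] bexI[of _ r] bexI[of _ 0]) (auto simp: mem intro: alg_gen.gen)
      next
        case 2
        \<comment> \<open>Cramer's rule: \<open>t\<close> and \<open>h'\<close> are linear in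
          \<open>z'\<close> and \<open>N'\<close> with determinant \<open>x1^5\<close>. The next
          case solves for \<open>z'\<close> in the same way.\<close>
        let ?P = "(x1^2 + a^6*x2^2)*h'" and ?Q = "a^4*x2^4 + a^5*x1^2*x2^2 + a^2*x1^3*x2"
        have "x1 ^ 5 * r = ?P + ?Q * t"
          by (simp add: 2 h'_def t_def S.char2_norm)
        moreover have "?P \<in> alg_gen ?A3" "?Q \<in> alg_gen ?A3"
          by (auto intro!: mem intro: alg_gen.gen)
        ultimately show ?thesis
          by blast
      next
        case 3
        let ?P = "a^4*x2*h'" and ?Q = "x1^3 + a^2*x2^3"
        have "x1 ^ 5 * r = ?P + ?Q * t"
          by (simp add: 3 h'_def t_def S.char2_norm)
        moreover have "?P \<in> alg_gen ?A3" "?Q \<in> alg_gen ?A3"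
          by (auto intro!: mem intro: alg_gen.gen)
        ultimately show ?thesis
          by blast
      qed
    qed
  qed (use inv F2 in \<open>simp_all add: rhom_\<tau> hom_simps alg_gen.gen\<close>)
  then obtain n3 where F3: "x1 ^ n3 * (x1 ^ n2 * (x1 ^ n1 * F)) \<in> alg_gen ?A3" by blast
  have "T \<in> alg_gen B"
    unfolding T_def t_def N'_def z'_def z_def N_def S.last_step_generators(2)
    by (auto intro!: mem intro: alg_gen.gen)
  moreover have "h' \<in> alg_gen B"
    unfolding h'_def N'_def z'_def z_def N_def S.last_step_generators(1)
    by (auto intro!: mem intro: alg_gen.gen)
  ultimately have "?A3 \<subseteq> alg_gen B"
    by (simp add: alg_gen.gen)
  from alg_gen_least[OF this F3] show ?thesis
    by (intro exI[of _ "n3 + n2 + n1"]) (simp add: power_add mult.assoc)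
qed


section \<open>Normal forms modulo x1 and cancellation of x1\<close>

abbreviation "ev \<equiv> pev (pev (pev pconst x2) f) g"

lemmas rhom_ev = rhom_pev[OF rhom_pev[OF rhom_pev[OF rhom_pconst]], of x2 f g]

lemmas ev_pCons = pev_pCons[OF rhom_pev[OF rhom_pev[OF rhom_pconst]], of x2 f g]
  pev_pCons[OF rhom_pev[OF rhom_pconst], of x2 f] pev_pCons[OF rhom_pconst, of x2]
  pev_0[OF rhom_pev[OF rhom_pev[OF rhom_pconst]], of x2 f g]
  pev_0[OF rhom_pev[OF rhom_pconst], of x2 f] pev_0[OF rhom_pconst, of x2]

lemma ev_simps [simp]: "ev 0 = 0" "ev 1 = 1" "ev [:[:[:c:]:]:] = pconst c" "ev [:[:[:0, 1:]:]:] = x2"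
    "ev [:[:0, 1:]:] = f" "ev [:0, 1:] = g"
  by (simp_all add: ev_pCons one_pCons)

lemma ev_range:
  assumes "F \<in> alg_gen {x2, f, g}"
  shows "\<exists>E. F = ev E"
  using assms
proof induction
  case (const c)
  show ?case by (metis ev_simps(3))
next
  case (gen r)
  then show ?case by (metis ev_simps(4-6) insert_iff singletonD)
next
  case (add F G)
  then show ?case by (metis rhom.add[OF rhom_ev])
next
  case (mult F G)
  then show ?case by (metis rhom.mult[OF rhom_ev])
qed

lemma pev_in_alg_gen:
  assumes "rhom c" "\<And>e. c e \<in> alg_gen A" "r \<in> alg_gen A"
  shows "pev c r E \<in> alg_gen A"
  by (induction E) (auto simp: pev_0[OF assms(1)] pev_pCons[OF assms(1)] alg_gen_0
      intro!: alg_gen.add alg_gen.mult assms)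

lemma ev_in_alg_gen: "ev E \<in> alg_gen {x2, f, g}"
  by (intro pev_in_alg_gen rhom_pev rhom_pconst alg_gen.const) (auto intro: alg_gen.gen)

text \<open>At \<open>x1 = 0\<close> the coefficient of \<open>g\<close> in
  \<open>inv_h_square\<close> vanishes, that of \<open>f\<close> becomes the square of
  \<open>a^2*x2^4\<close>, and that of \<open>h\<close> becomes \<open>a^4*x2^6\<close>.\<close>

lemma h_square_mod_x1: "\<exists>U\<in>alg_gen B. h * h = x1 * U + a^4*x2^8 * f + a^4*x2^6 * h"
proof
  let ?U = "x2^2*x1*(x1^2 + a^3*x1*x2)^2 * f + x1*(x1^3 + a^2*x2^3)^2 * g
    + (x1^5 + a^3*x1^4*x2 + a^6*x1^3*x2^2 + a^5*x1*x2^4) * h"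
  \<comment> \<open>Only coefficients matter here, so letters stand for \<open>f\<close>,
    \<open>g\<close>, \<open>h\<close> and the invariants are not expanded.\<close>
  have gen: "(x2*(x1^3 + a^3*x1^2*x2 + a^2*x2^3))^2 * F + (x1*(x1^3 + a^2*x2^3))^2 * G
     + (x1^6 + a^3*x1^5*x2 + a^6*x1^4*x2^2 + a^5*x1^2*x2^4 + a^4*x2^6) * H
   = x1 * (x2^2*x1*(x1^2 + a^3*x1*x2)^2 * F + x1*(x1^3 + a^2*x2^3)^2 * G
    + (x1^5 + a^3*x1^4*x2 + a^6*x1^3*x2^2 + a^5*x1*x2^4) * H) + a^4*x2^8 * F + a^4*x2^6 * H" for F G H
    by (simp add: S.char2_norm)
  show "h * h = x1 * ?U + a^4*x2^8 * f + a^4*x2^6 * h"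
    unfolding S.inv_h_square by (rule gen)
  show "?U \<in> alg_gen B"
    by (auto intro!: alg_gen.add alg_gen.mult alg_gen_power alg_gen.const intro: alg_gen.gen)
qed

text \<open>Powers of \<open>h\<close> above the first are reduced by
  \<open>h_square_mod_x1\<close>. The decisive point is that the cofactor \<open>F'\<close> of
  \<open>x1\<close> stays in the algebra.\<close>

lemma decompose_mod_x1:
  assumes "F \<in> alg_gen B"
  shows "\<exists>F'\<in>alg_gen B. \<exists>E0 E1. F = x1 * F' + ev E0 + ev E1 * h"
  using assms
proof induction
  case (const c)
  have "pconst c = x1 * 0 + ev [:[:[:c:]:]:] + ev 0 * h" by simp
  then show ?case
    using alg_gen_0 by blast
next
  case (gen r)
  have "x1 = x1 * 1 + ev 0 + ev 0 * h" "x2 = x1 * 0 + ev [:[:[:0, 1:]:]:] + ev 0 * h"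
    "f = x1 * 0 + ev [:[:0, 1:]:] + ev 0 * h" "g = x1 * 0 + ev [:0, 1:] + ev 0 * h"
    "h = x1 * 0 + ev 0 + ev 1 * h"
    by simp_all
  then show ?case
    using gen alg_gen_0 alg_gen_1 by (metis (no_types, lifting) insert_iff singletonD)
next
  case (add F G)
  then obtain F' E0 E1 G' D0 D1 where "F' \<in> alg_gen B" "G' \<in> alg_gen B"
    and "F = x1 * F' + ev E0 + ev E1 * h" "G = x1 * G' + ev D0 + ev D1 * h"
    by blast
  then show ?case
    by (intro bexI[of _ "F' + G'"] exI[of _ "E0 + D0"] exI[of _ "E1 + D1"])
      (simp_all add: rhom.add[OF rhom_ev] algebra_simps alg_gen.add)
next
  case (mult F G)
  then obtain F' E0 E1 G' D0 D1 where B: "F' \<in> alg_gen B" "G' \<in> alg_gen B"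
    and eq: "F = x1 * F' + ev E0 + ev E1 * h" "G = x1 * G' + ev D0 + ev D1 * h"
    by blast
  have "{x2, f, g} \<subseteq> alg_gen B"
    by (auto intro: alg_gen.gen)
  then have ev_B: "ev E \<in> alg_gen B" for E
    using alg_gen_least[OF _ ev_in_alg_gen] by blast
  have "a^4*x2^8*f \<in> alg_gen {x2, f, g}" "a^4*x2^6 \<in> alg_gen {x2, f, g}"
    by (auto intro!: alg_gen.mult alg_gen_power alg_gen.const intro: alg_gen.gen)
  then obtain V0 V1 U where U: "U \<in> alg_gen B" "h * h = x1 * U + ev V0 + ev V1 * h"
    using h_square_mod_x1 ev_range by metis
  let ?H = "F' * G + (ev E0 + ev E1 * h) * G' + ev E1 * ev D1 * U"
  let ?C0 = "E0 * D0 + E1 * D1 * V0" and ?C1 = "E0 * D1 + E1 * D0 + E1 * D1 * V1"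
  have "F * G = x1 * (F' * G + (ev E0 + ev E1 * h) * G')
      + ev E0 * ev D0 + (ev E0 * ev D1 + ev E1 * ev D0) * h + ev E1 * ev D1 * (h * h)"
    unfolding eq by (simp add: algebra_simps)
  also have "\<dots> = x1 * ?H + ev ?C0 + ev ?C1 * h"
    unfolding U(2) rhom.add[OF rhom_ev] rhom.mult[OF rhom_ev] by (simp add: algebra_simps)
  finally have "F * G = x1 * ?H + ev ?C0 + ev ?C1 * h" .
  moreover have "?H \<in> alg_gen B"
    using B ev_B mult.hyps U(1) by (auto intro!: alg_gen.add alg_gen.mult intro: alg_gen.gen)
  ultimately show ?case
    by blast
qed

text \<open>Setting \<open>x1 = 0\<close> kills the left side for an arbitrary polynomial
  \<open>F\<close>, and \<open>pcompose_independent\<close> applies to what is left of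
  \<open>f\<close>, \<open>g\<close>, \<open>h\<close>.\<close>

lemma independent_mod_x1:
  assumes "x1 * F = ev E0 + ev E1 * h"
  shows "E0 = 0 \<and> E1 = 0"
proof -
  define c :: "'k \<Rightarrow> 'k poly poly poly" where "c = (\<lambda>a. [:[:[:a:]:]:])"
  define \<phi> where "\<phi> = peval c (\<lambda>v. case v of X1 \<Rightarrow> 0 | X2 \<Rightarrow> [:[:[:0, 1:]:]:] | Y1 \<Rightarrow> [:[:0, 1:]:] | Y2 \<Rightarrow> [:0, 1:])"
  have "rhom c"
    unfolding c_def by (intro rhom_comp[OF rhom_const_poly] rhom_const_poly)
  note hom = rhom_peval[OF this] peval_pconst[OF this] peval_pvar[OF this]
  have \<phi>: "rhom \<phi>" "\<phi> (pconst b) = c b" "\<phi> x1 = 0" "\<phi> x2 = [:[:[:0, 1:]:]:]"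
    "\<phi> y1 = [:[:0, 1:]:]" "\<phi> y2 = [:0, 1:]" for b
    unfolding \<phi>_def by (simp_all add: hom)
  \<comment> \<open>The values of \<open>f\<close> and \<open>h\<close> at \<open>x1 = 0\<close>,
    written as polynomials in \<open>y1\<close> over k[x2].\<close>
  define f' where "f' = [:0, [:0, 0, 0, \<alpha>^3:], 0, 0, 1:]"
  define h' where "h' = [:0, [:0, 0, 0, 0, 0, \<alpha>^3:], [:0, 0, 0, 0, \<alpha>^2:]:]"
  note rules = \<phi> c_def inv_fgh_defs power_numeral_reduce one_pCons
  have f': "\<phi> f = [:f':]"
    unfolding rhom.inv_fgh[OF \<phi>(1)] by (simp add: rules f'_def)
  have h': "\<phi> h = [:h':]"
    unfolding rhom.inv_fgh[OF \<phi>(1)] by (simp add: rules h'_def)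
  have g': "degree (\<phi> g) = 4"
    unfolding rhom.inv_fgh[OF \<phi>(1)] by (simp add: rules)
  have \<phi>ev: "\<phi> (ev E) = pcompose (map_poly (\<lambda>e. pcompose e f') E) (\<phi> g)" for E
  proof -
    note r1 = rhom_pconst and r2 = rhom_pev[OF rhom_pconst] and r3 = rhom_pev[OF rhom_pev[OF rhom_pconst]]
    have "\<phi> (ev E) = pev (pev (pev (\<lambda>a. \<phi> (pconst a)) (\<phi> x2)) (\<phi> f)) (\<phi> g) E"
      by (simp only: rhom_pev_comp[OF \<phi>(1) r1] rhom_pev_comp[OF \<phi>(1) r2] rhom_pev_comp[OF \<phi>(1) r3])
    then show ?thesis
      by (simp add: \<phi> f' c_def pev_tower)
  qed
  have "\<phi> (ev E0 + ev E1 * h) = \<phi> (x1 * F)"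
    by (simp add: assms)
  then have "\<phi> (ev E0) + \<phi> (ev E1) * [:h':] = 0"
    by (simp add: rhom.add[OF \<phi>(1)] rhom.mult[OF \<phi>(1)] \<phi>(3) h')
  moreover have "degree f' = 4" "degree h' = 2"
    using \<alpha>_nonzero by (simp_all add: f'_def h'_def)
  ultimately show ?thesis
    using pcompose_independent[of f' h' "\<phi> g" E0 E1] g' by (simp add: \<phi>ev)
qed

text \<open>The normal form of \<open>x1 * F\<close> modulo \<open>x1\<close> has to vanish, so
  \<open>F\<close> equals the cofactor \<open>F'\<close>.\<close>

lemma cancel_x1:
  assumes "x1 * F \<in> alg_gen B"
  shows "F \<in> alg_gen B"
proof -
  obtain F' E0 E1 where F': "F' \<in> alg_gen B" and eq: "x1 * F = x1 * F' + ev E0 + ev E1 * h"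
    using decompose_mod_x1[OF assms] by blast
  then have "x1 * (F - F') = ev E0 + ev E1 * h"
    by (simp add: algebra_simps)
  from independent_mod_x1[OF this] have "x1 * (F - F') = 0"
    using eq by (simp add: algebra_simps)
  then show ?thesis
    using F' pvar_nonzero by simp
qed

theorem invariants_eq_alg_gen: "alg_gen B = {F. \<sigma> F = F \<and> \<tau> \<alpha> F = F \<and> \<rho> \<alpha> F = F}"
proof (intro equalityI subsetI CollectI conjI)
  fix F assume F: "F \<in> alg_gen B"
  show "\<sigma> F = F"
    by (rule alg_gen_fixed[OF rhom_\<sigma> _ _ F]) (use B_fixed in auto)
  show "\<tau> \<alpha> F = F"
    by (rule alg_gen_fixed[OF rhom_\<tau> _ _ F]) (use B_fixed in auto)
  show "\<rho> \<alpha> F = F"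
    by (rule alg_gen_fixed[OF rhom_\<rho> _ _ F]) (use B_fixed in auto)
next
  fix F assume "F \<in> {F. \<sigma> F = F \<and> \<tau> \<alpha> F = F \<and> \<rho> \<alpha> F = F}"
  then obtain n where "x1 ^ n * F \<in> alg_gen B"
    using invariants_localized by blast
  then show "F \<in> alg_gen B"
    by (induction n) (simp_all add: cancel_x1 mult.assoc)
qed

text \<open>Modulo \<open>x1\<close> every element generated without \<open>h\<close> has normal
  form \<open>ev E\<close>, while \<open>h\<close> has the coordinate 1 at \<open>h\<close>;
  independence excludes equality.\<close>

lemma h_notin: "h \<notin> alg_gen {x1, x2, f, g}"
proof
  assume "h \<in> alg_gen {x1, x2, f, g}"
  moreover have "\<exists>F'. \<exists>E. F = x1 * F' + ev E" if "F \<in> alg_gen {x1, x2, f, g}" for F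
    using that
  proof induction
    case (const c)
    have "pconst c = x1 * 0 + ev [:[:[:c:]:]:]" by simp
    then show ?case by blast
  next
    case (gen r)
    have "x1 = x1 * 1 + ev 0" "x2 = x1 * 0 + ev [:[:[:0, 1:]:]:]"
      "f = x1 * 0 + ev [:[:0, 1:]:]" "g = x1 * 0 + ev [:0, 1:]"
      by simp_all
    then show ?case
      using gen by (metis (no_types, lifting) insert_iff singletonD)
  next
    case (add F G)
    then obtain F' E G' D where "F = x1 * F' + ev E" "G = x1 * G' + ev D" by blast
    then have "F + G = x1 * (F' + G') + ev (E + D)"
      by (simp add: rhom.add[OF rhom_ev] algebra_simps)
    then show ?case by blast
  next
    case (mult F G)
    then obtain F' E G' D where "F = x1 * F' + ev E" "G = x1 * G' + ev D" by blast
    then have "F * G = x1 * (F' * G + ev E * G') + ev (E * D)"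
      by (simp add: rhom.mult[OF rhom_ev] algebra_simps)
    then show ?case by blast
  qed
  ultimately obtain F' E where "h = x1 * F' + ev E" by blast
  then have "x1 * F' = ev (- E) + ev 1 * h"
    by (simp add: rhom.uminus[OF rhom_ev])
  then show False
    using independent_mod_x1 by fastforce
qed

end

section \<open>Squares of ideals and minimal generators\<close>

lemma ideal_square_mult: "x \<in> I \<Longrightarrow> y \<in> I \<Longrightarrow> x * y \<in> ideal_square I"
  unfolding ideal_square_def
  by (rule CollectI, rule exI[of _ 1], rule exI[of _ "\<lambda>_. x"], rule exI[of _ "\<lambda>_. y"]) simp

lemma ideal_square_0: "0 \<in> ideal_square I"
  unfolding ideal_square_def by (rule CollectI, rule exI[of _ 0]) simp

lemma ideal_square_add:
  assumes "x \<in> ideal_square I" "y \<in> ideal_square I"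
  shows "x + y \<in> ideal_square I"
proof -
  obtain n and a b :: "nat \<Rightarrow> _" where x: "x = (\<Sum>i<n. a i * b i)" "\<forall>i<n. a i \<in> I \<and> b i \<in> I"
    using assms(1) by (auto simp: ideal_square_def)
  obtain m and c d :: "nat \<Rightarrow> _" where y: "y = (\<Sum>i<m. c i * d i)" "\<forall>i<m. c i \<in> I \<and> d i \<in> I"
    using assms(2) by (auto simp: ideal_square_def)
  define a' where "a' i = (if i < n then a i else c (i - n))" for i
  define b' where "b' i = (if i < n then b i else d (i - n))" for i
  have "(\<Sum>i<n + m. a' i * b' i) = (\<Sum>i<n. a' i * b' i) + (\<Sum>i<m. a' (n + i) * b' (n + i))"
    by (induction m) (simp_all add: add.assoc)
  then have "x + y = (\<Sum>i<n + m. a' i * b' i)"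
    by (simp add: x(1) y(1) a'_def b'_def)
  moreover have "\<forall>i<n + m. a' i \<in> I \<and> b' i \<in> I"
    using x(2) y(2) by (auto simp: a'_def b'_def)
  ultimately show ?thesis
    unfolding ideal_square_def by blast
qed

lemma ideal_square_sum: "(\<And>i. i \<in> J \<Longrightarrow> x i \<in> ideal_square I) \<Longrightarrow> (\<Sum>i\<in>J. x i) \<in> ideal_square I"
  by (induction J rule: infinite_finite_induct) (auto intro: ideal_square_0 ideal_square_add)

lemma ideal_square_scale:
  assumes "\<And>y. y \<in> I \<Longrightarrow> r * y \<in> I" "x \<in> ideal_square I"
  shows "r * x \<in> ideal_square I"
proof -
  obtain n and a b :: "nat \<Rightarrow> _" where x: "x = (\<Sum>i<n. a i * b i)" "\<forall>i<n. a i \<in> I \<and> b i \<in> I"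
    using assms(2) by (auto simp: ideal_square_def)
  have "r * x = (\<Sum>i<n. (r * a i) * b i)"
    by (simp add: x(1) sum_distrib_left mult.assoc)
  also have "\<dots> \<in> ideal_square I"
    by (intro ideal_square_sum ideal_square_mult) (use x(2) assms(1) in auto)
  finally show ?thesis .
qed

text \<open>The end terms \<open>i = 0\<close> and \<open>i = d\<close> contain a vanishing constant
  component, so both factors of each remaining term have degree below \<open>d\<close>.\<close>

lemma hcomp_mult_pos:
  assumes "hcomp 0 p = 0" "hcomp 0 q = 0"
  shows "hcomp d (p * q) = (\<Sum>i\<in>{0<..<d}. hcomp i p * hcomp (d - i) q)"
  unfolding hcomp_mult
  by (rule sum.mono_neutral_right) (use assms in \<open>auto simp: not_less\<close>)

text \<open>A generator of degree \<open>d\<close> cannot contribute to components of smaller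
  degree.\<close>

lemma hcomp_alg_gen_remove:
  assumes hom: "\<forall>r\<in>A. \<exists>e. r \<in> graded_piece e" and N: "N \<in> graded_piece d"
    and F: "F \<in> alg_gen A" and j: "j < d"
  shows "hcomp j F \<in> alg_gen (A - {N})"
  using F j
proof (induction arbitrary: j)
  case (const c)
  show ?case
    by (simp add: hcomp_of_graded_piece[OF graded_piece_pconst] alg_gen.const alg_gen_0)
next
  case (gen r)
  obtain e where e: "r \<in> graded_piece e"
    using hom gen by blast
  show ?case
  proof (cases "r = N")
    case True
    then show ?thesis
      using hcomp_of_graded_piece[OF N, of j] gen by (simp add: alg_gen_0)
  next
    case False
    then show ?thesis
      using gen by (auto simp: hcomp_of_graded_piece[OF e] alg_gen_0 intro: alg_gen.gen)
  qed
next
  case (add F G)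
  then show ?case by (simp add: hcomp_add alg_gen.add)
next
  case (mult F G)
  then show ?case by (auto simp: hcomp_mult intro!: alg_gen_sum alg_gen.mult)
qed

text \<open>The easy half of the graded Nakayama lemma: the degree \<open>d\<close> part of a sum of
  products of positive-degree invariants uses only components of degree below \<open>d\<close>.
  These are generated without \<open>N\<close>, which makes \<open>N\<close> redundant.\<close>

lemma decomposable_notin_min_hom_gen_set:
  assumes A: "min_hom_gen_set A (inv_ring G)"
    and N: "N \<in> graded_piece d" "N \<in> ideal_square (inv_ring_pos G)"
  shows "N \<notin> A"
proof
  assume "N \<in> A"
  from A have hom: "\<forall>r\<in>A. \<exists>e. r \<in> graded_piece e" and gen: "alg_gen A = inv_ring G"
    and min: "\<And>A'. A' \<subset> A \<Longrightarrow> alg_gen A' \<noteq> inv_ring G"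
    by (auto simp: min_hom_gen_set_def)
  obtain n and p q :: "nat \<Rightarrow> _" where Neq: "N = (\<Sum>i<n. p i * q i)"
    and pq: "\<forall>i<n. p i \<in> inv_ring_pos G \<and> q i \<in> inv_ring_pos G"
    using N(2) by (auto simp: ideal_square_def)
  have "hcomp d (p i * q i) \<in> alg_gen (A - {N})" if "i < n" for i
  proof -
    have "hcomp 0 (p i) = 0" "hcomp 0 (q i) = 0" "p i \<in> alg_gen A" "q i \<in> alg_gen A"
      using pq that gen by (auto simp: inv_ring_pos_def hcomp_0_eq_pconst)
    then show ?thesis
      by (auto simp: hcomp_mult_pos intro!: alg_gen_sum alg_gen.mult hcomp_alg_gen_remove[OF hom N(1)])
  qed
  then have "hcomp d N \<in> alg_gen (A - {N})"
    by (subst Neq) (auto simp: hcomp_sum intro!: alg_gen_sum)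
  then have "A \<subseteq> alg_gen (A - {N})"
    using hcomp_of_graded_piece[OF N(1), of d] by (auto intro: alg_gen.gen)
  then have "alg_gen (A - {N}) = alg_gen A"
    by (meson Diff_subset alg_gen.gen alg_gen_least subset_antisym subset_iff)
  then show False
    using min[of "A - {N}"] gen \<open>N \<in> A\<close> by blast
qed

lemma alg_gen_killed:
  assumes "rhom \<phi>" "\<And>c. \<phi> (pconst c) = pconst c" "\<And>r. r \<in> A \<Longrightarrow> \<phi> r = 0" "F \<in> alg_gen A"
  shows "\<exists>c. \<phi> F = pconst c"
  using assms(4)
proof induction
  case (gen r)
  show ?case by (rule exI[of _ 0]) (simp add: assms(3) gen)
next
  case (add F G)
  then show ?case by (metis pconst_add rhom.add[OF assms(1)])
next
  case (mult F G)
  then show ?case by (metis pconst_mult rhom.mult[OF assms(1)])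
qed (use assms(2) in blast)

lemma pvar_power_neq_pconst:
  fixes v :: "'v::{finite,linorder}"
  assumes "n > 0"
  shows "(pvar v :: ('v, 'k::field) mpoly) ^ n \<noteq> pconst c"
proof
  assume eq: "(pvar v :: ('v, 'k) mpoly) ^ n = pconst c"
  have "(pvar v :: ('v, 'k) mpoly) ^ n \<in> graded_piece n"
    using graded_piece_power[OF graded_piece_pvar[of v], of n] by simp
  then have "hcomp n ((pvar v :: ('v, 'k) mpoly) ^ n) = pvar v ^ n"
    by (simp add: hcomp_of_graded_piece)
  moreover have "hcomp n (pconst c :: ('v, 'k) mpoly) = 0"
    using assms by (simp add: hcomp_of_graded_piece[OF graded_piece_pconst])
  ultimately have "(pvar v :: ('v, 'k) mpoly) ^ n = 0"
    using eq by simp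
  then have "(pvar v :: ('v, 'k) mpoly) = 0"
    by simp
  then show False
    unfolding pvar_def by (metis lookup_single_eq lookup_zero zero_neq_one)
qed

lemma linear_form_expansion:
  assumes "l \<in> linear_forms"
  shows "l = (\<Sum>v\<in>UNIV. pconst (Poly_Mapping.lookup l (Poly_Mapping.single v 1)) * pvar v)"
proof (rule poly_mapping_eqI)
  fix m :: "'a \<Rightarrow>\<^sub>0 nat"
  have *: "pconst c * pvar v = Poly_Mapping.single (Poly_Mapping.single v 1) c" for c :: 'b and v :: 'a
    by (simp add: pconst_def pvar_def mult_single)
  have inj: "Poly_Mapping.single w (1::nat) = Poly_Mapping.single v 1 \<longleftrightarrow> w = v" for w v :: 'a
    by (metis lookup_single_eq lookup_single_not_eq zero_neq_one)
  show "Poly_Mapping.lookup l m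
    = Poly_Mapping.lookup (\<Sum>v\<in>UNIV. pconst (Poly_Mapping.lookup l (Poly_Mapping.single v 1)) * pvar v) m"
  proof (cases "\<exists>v. m = Poly_Mapping.single v 1")
    case True
    then show ?thesis
      by (auto simp: * lookup_sum lookup_single when_def inj simp del: One_nat_def)
  next
    case False
    have "mdegree m \<noteq> 1"
    proof
      assume "mdegree m = 1"
      then obtain v where v: "Poly_Mapping.lookup m v = 1" "\<And>w. w \<noteq> v \<Longrightarrow> Poly_Mapping.lookup m w = 0"
        unfolding mdegree_def using sum_eq_1_iff[of UNIV "Poly_Mapping.lookup m"] by force
      then have "m = Poly_Mapping.single v 1"
        by (intro poly_mapping_eqI) (auto simp: lookup_single when_def)
      with False show False by blast
    qed
    then have "Poly_Mapping.lookup l m = 0"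
      using assms by (auto simp: graded_piece_iff)
    moreover have "Poly_Mapping.single v 1 \<noteq> m" for v
      using False by metis
    ultimately show ?thesis
      by (simp add: * lookup_sum lookup_single when_def)
  qed
qed

lemma UNIV_var: "(UNIV :: var set) = {X1, X2, Y1, Y2}"
  using var.exhaust by blast

section \<open>Degrees and irredundancy of the five generators\<close>

context counterexample
begin

text \<open>Restriction to a coordinate axis, that is, setting all variables but one to 0, leaves
  exactly one of \<open>x1\<close>, \<open>x2\<close>, \<open>f\<close>, \<open>g\<close> nonzero.
  As \<open>h\<close> contains no pure power it vanishes on every axis, and its own irredundancy
  needs \<open>h_notin\<close>.\<close>

lemma generator_notin:
  "x1 \<notin> alg_gen {x2, f, g, h}" "x2 \<notin> alg_gen {x1, f, g, h}"
  "f \<notin> alg_gen {x1, x2, g, h}" "g \<notin> alg_gen {x1, x2, f, h}"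
proof -
  define \<psi> :: "var \<Rightarrow> (var, 'k) mpoly \<Rightarrow> (var, 'k) mpoly"
    where "\<psi> v = psubst (\<lambda>w. if w = v then pvar v else 0)" for v
  have \<psi>: "rhom (\<psi> v)" "\<psi> v (pconst c) = pconst c" "\<psi> v (pvar w) = (if w = v then pvar v else 0)" for v w c
    by (simp_all add: \<psi>_def rhom_psubst)
  have \<psi>_inv: "\<psi> v f = inv_f a (\<psi> v x1) (\<psi> v x2) (\<psi> v y1) (\<psi> v y2)"
    "\<psi> v g = inv_g a (\<psi> v x1) (\<psi> v x2) (\<psi> v y1) (\<psi> v y2)"
    "\<psi> v h = inv_h a (\<psi> v x1) (\<psi> v x2) (\<psi> v y1) (\<psi> v y2)" for v
    by (simp_all only: rhom.inv_fgh[OF \<psi>(1)] \<psi>(2))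
  have \<psi>_fgh: "\<psi> v f = (if v = Y1 then y1 ^ 4 else 0)" "\<psi> v g = (if v = Y2 then y2 ^ 4 else 0)" "\<psi> v h = 0" for v
    unfolding \<psi>_inv by (cases v; simp add: \<psi>(3) inv_fgh_defs)+
  have gen: "F \<notin> alg_gen A" if "\<And>r. r \<in> A \<Longrightarrow> \<psi> v r = 0" "\<psi> v F = pvar v ^ n" "n > 0" for A F v n
    using alg_gen_killed[OF \<psi>(1) \<psi>(2) that(1)] pvar_power_neq_pconst[OF that(3)] that(2) by metis
  show "x1 \<notin> alg_gen {x2, f, g, h}"
    by (rule gen[of _ X1 _ 1]) (auto simp: \<psi>(3) \<psi>_fgh)
  show "x2 \<notin> alg_gen {x1, f, g, h}"
    by (rule gen[of _ X2 _ 1]) (auto simp: \<psi>(3) \<psi>_fgh)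
  show "f \<notin> alg_gen {x1, x2, g, h}"
    by (rule gen[of _ Y1 _ 4]) (auto simp: \<psi>(3) \<psi>_fgh)
  show "g \<notin> alg_gen {x1, x2, f, h}"
    by (rule gen[of _ Y2 _ 4]) (auto simp: \<psi>(3) \<psi>_fgh)
qed

lemma graded_generators:
  "f \<in> graded_piece 4" "g \<in> graded_piece 4" "h \<in> graded_piece 6"
proof -
  have monom: "pconst c * (x1 ^ i * (x2 ^ j * (y1 ^ k * y2 ^ l))) \<in> graded_piece d" if "d = i + j + k + l" for c d i j k l
    using graded_piece_mult[OF graded_piece_pconst[of c] graded_piece_mult[OF graded_piece_power[OF graded_piece_pvar[of X1], of i]
      graded_piece_mult[OF graded_piece_power[OF graded_piece_pvar[of X2], of j]
        graded_piece_mult[OF graded_piece_power[OF graded_piece_pvar[of Y1], of k] graded_piece_power[OF graded_piece_pvar[of Y2], of l]]]]]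
    by (simp add: that add.assoc)
  have f: "f = pconst 1 * (x1^0 * (x2^0 * (y1^4 * y2^0))) + pconst (\<alpha>^3) * (x1^2 * (x2^0 * (y1^2 * y2^0)))
     + pconst (\<alpha>^2) * (x1^1 * (x2^1 * (y1^0 * y2^2))) + pconst \<alpha> * (x1^3 * (x2^0 * (y1^1 * y2^0)))
     + pconst (\<alpha>^3) * (x1^0 * (x2^3 * (y1^1 * y2^0))) + pconst (\<alpha>^5) * (x1^1 * (x2^2 * (y1^0 * y2^1)))"
    by (simp add: inv_f_def pconst_power algebra_simps)
  show "f \<in> graded_piece 4"
    unfolding f by (intro graded_piece_add monom) simp_all
  have g: "g = pconst 1 * (x1^0 * (x2^0 * (y1^0 * y2^4))) + pconst 1 * (x1^1 * (x2^1 * (y1^2 * y2^0)))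
     + pconst (\<alpha>^3) * (x1^0 * (x2^2 * (y1^2 * y2^0))) + pconst (\<alpha>^3) * (x1^1 * (x2^1 * (y1^0 * y2^2)))
     + pconst (\<alpha>^6) * (x1^0 * (x2^2 * (y1^0 * y2^2))) + pconst (\<alpha>^4) * (x1^0 * (x2^3 * (y1^1 * y2^0)))
     + pconst 1 * (x1^3 * (x2^0 * (y1^0 * y2^1))) + pconst (\<alpha>^3) * (x1^2 * (x2^1 * (y1^0 * y2^1)))
     + pconst (\<alpha>^6) * (x1^1 * (x2^2 * (y1^0 * y2^1))) + pconst (\<alpha>^2) * (x1^0 * (x2^3 * (y1^0 * y2^1)))"
    by (simp add: inv_g_def pconst_power algebra_simps)
  show "g \<in> graded_piece 4"
    unfolding g by (intro graded_piece_add monom) simp_all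
  have h: "h = pconst 1 * (x1^3 * (x2^1 * (y1^2 * y2^0))) + pconst (\<alpha>^3) * (x1^2 * (x2^2 * (y1^2 * y2^0)))
     + pconst (\<alpha>^2) * (x1^0 * (x2^4 * (y1^2 * y2^0))) + pconst 1 * (x1^4 * (x2^0 * (y1^0 * y2^2)))
     + pconst (\<alpha>^2) * (x1^1 * (x2^3 * (y1^0 * y2^2))) + pconst \<alpha> * (x1^3 * (x2^2 * (y1^1 * y2^0)))
     + pconst (\<alpha>^3) * (x1^0 * (x2^5 * (y1^1 * y2^0))) + pconst 1 * (x1^5 * (x2^0 * (y1^0 * y2^1)))
     + pconst (\<alpha>^2) * (x1^2 * (x2^3 * (y1^0 * y2^1))) + pconst (\<alpha>^5) * (x1^1 * (x2^4 * (y1^0 * y2^1)))"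
    by (simp only: inv_h_def pconst_power pconst_1) (simp add: S.char2_norm)
  show "h \<in> graded_piece 6"
    unfolding h by (intro graded_piece_add monom) simp_all
qed

lemma generators_minimal:
  assumes "A \<subset> B"
  shows "alg_gen A \<noteq> alg_gen B"
proof
  assume eq: "alg_gen A = alg_gen B"
  obtain r where r: "r \<in> B" "r \<notin> A"
    using assms by blast
  have "r \<in> alg_gen A"
    unfolding eq by (rule alg_gen.gen[OF r(1)])
  \<comment> \<open>\<open>C\<close> plays the role of \<open>B\<close> without \<open>r\<close>.
    The form \<open>B \<subseteq> insert r C\<close> avoids deciding which generators are equal,
    which a set difference would require.\<close>
  moreover have "A \<subseteq> alg_gen C" if "B \<subseteq> insert r C" for C
  proof
    fix s assume "s \<in> A"
    moreover have "A \<subseteq> insert r C"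
      using assms that by (meson order_trans psubset_imp_subset)
    ultimately have "s \<in> C"
      using r(2) by auto
    then show "s \<in> alg_gen C"
      by (rule alg_gen.gen)
  qed
  ultimately have in_C: "r \<in> alg_gen C" if "B \<subseteq> insert r C" for C
    using alg_gen_least that by meson
  from r(1) consider "r = x1" | "r = x2" | "r = f" | "r = g" | "r = h"
    by auto
  then show False
  proof cases
    case 1
    then show ?thesis using in_C[of "{x2, f, g, h}"] generator_notin by simp
  next
    case 2
    then show ?thesis using in_C[of "{x1, f, g, h}"] generator_notin by simp
  next
    case 3
    then show ?thesis using in_C[of "{x1, x2, g, h}"] generator_notin by simp
  next
    case 4
    then show ?thesis using in_C[of "{x1, x2, f, h}"] generator_notin by simp
  next
    case 5
    then show ?thesis using in_C[of "{x1, x2, f, g}"] h_notin by simp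
  qed
qed

lemma distinct_generators: "distinct [x1, x2, f, g, h]"
proof -
  have "r \<notin> C" if "r \<notin> alg_gen C" for r :: "(var, 'k) mpoly" and C
    using that alg_gen.gen by blast
  note this[OF generator_notin(1)] this[OF generator_notin(2)] this[OF generator_notin(3)]
    this[OF generator_notin(4)]
  then show ?thesis by simp
qed

end

section \<open>The group\<close>

lemma mult_BijGroup: "bij p \<Longrightarrow> bij q \<Longrightarrow> p \<otimes>\<^bsub>BijGroup UNIV\<^esub> q = p \<circ> q"
  by (auto simp: BijGroup_def Bij_def compose_def fun_eq_iff)

lemma carrier_BijGroup: "p \<in> carrier (BijGroup UNIV) \<longleftrightarrow> bij p"
  by (auto simp: BijGroup_def Bij_def)

context counterexample
begin

text \<open>On parameters 0 and 1 this is the product of the corresponding powers of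
  \<open>\<sigma>\<close>, \<open>\<tau> \<alpha>\<close>, \<open>\<rho> \<alpha>\<close>. With
  parameters in the whole field, composition is simply addition of parameters.\<close>

definition tr :: "'k \<Rightarrow> 'k \<Rightarrow> 'k \<Rightarrow> (var, 'k) mpoly \<Rightarrow> (var, 'k) mpoly" where
  "tr p q r = psubst (\<lambda>v. case v of
     X1 \<Rightarrow> x1 | X2 \<Rightarrow> x2
   | Y1 \<Rightarrow> y1 + (pconst (p + r * \<alpha>\<^sup>2) * x1 + pconst (q * \<alpha>) * x2)
   | Y2 \<Rightarrow> y2 + (pconst q * x1 + pconst (p + r * (\<alpha> + \<alpha>\<^sup>2)) * x2))"

lemma rhom_tr: "rhom (tr p q r)"
  by (simp add: tr_def rhom_psubst)

lemma tr_simps [simp]: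
  "tr p q r (pconst c) = pconst c" "tr p q r x1 = x1" "tr p q r x2 = x2"
  "tr p q r y1 = y1 + (pconst (p + r * \<alpha>\<^sup>2) * x1 + pconst (q * \<alpha>) * x2)"
  "tr p q r y2 = y2 + (pconst q * x1 + pconst (p + r * (\<alpha> + \<alpha>\<^sup>2)) * x2)"
  by (simp_all add: tr_def)

lemma tr_comp: "tr p q r \<circ> tr p' q' r' = tr (p + p') (q + q') (r + r')"
proof (rule rhom_eqI)
  show "rhom (tr p q r \<circ> tr p' q' r')"
    using rhom_comp[OF rhom_tr rhom_tr] by (simp add: comp_def)
  fix v
  show "(tr p q r \<circ> tr p' q' r') (pvar v) = tr (p + p') (q + q') (r + r') (pvar v)"
    by (cases v) (simp_all add: rhom.add[OF rhom_tr] rhom.mult[OF rhom_tr] pconst_add pconst_mult algebra_simps)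
qed (simp_all add: rhom_tr)

lemma tr_0: "tr 0 0 0 = id"
proof (rule rhom_eqI)
  show "tr 0 0 0 (pvar v) = id (pvar v)" for v
    by (cases v) simp_all
  show "rhom (id :: (var, 'k) mpoly \<Rightarrow> _)"
    by (simp add: rhom_def)
qed (simp_all add: rhom_tr)

lemma tr_generators: "\<sigma> = tr 1 0 0" "\<tau> \<alpha> = tr 0 1 0" "\<rho> \<alpha> = tr 0 0 1"
proof -
  show "\<sigma> = tr 1 0 0"
  proof (rule rhom_eqI[OF rhom_\<sigma> rhom_tr])
    show "\<sigma> (pvar v) = tr 1 0 0 (pvar v)" for v
      by (cases v) simp_all
  qed simp
  show "\<tau> \<alpha> = tr 0 1 0"
  proof (rule rhom_eqI[OF rhom_\<tau> rhom_tr])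
    show "\<tau> \<alpha> (pvar v) = tr 0 1 0 (pvar v)" for v
      by (cases v) simp_all
  qed simp
  show "\<rho> \<alpha> = tr 0 0 1"
  proof (rule rhom_eqI[OF rhom_\<rho> rhom_tr])
    show "\<rho> \<alpha> (pvar v) = tr 0 0 1 (pvar v)" for v
      by (cases v) (simp_all add: pconst_add pconst_power)
  qed simp
qed

lemma tr_self_inverse: "tr p q r \<circ> tr p q r = id"
  by (simp add: tr_comp k.add_self tr_0)

lemma bij_tr: "bij (tr p q r)"
  using tr_self_inverse o_bij by blast

lemma tr_graded_alg_aut: "tr p q r \<in> graded_alg_auts"
proof -
  have lin: "pconst c * pvar v \<in> (graded_piece 1 :: (var, 'k) mpoly set)" for c v
    using graded_piece_mult[OF graded_piece_pconst graded_piece_pvar] by simp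
  have "tr p q r F \<in> graded_piece d" if "F \<in> graded_piece d" for F d
    unfolding tr_def
  proof (rule psubst_graded_piece[OF _ that])
    fix v
    show "(case v of X1 \<Rightarrow> x1 | X2 \<Rightarrow> x2
       | Y1 \<Rightarrow> y1 + (pconst (p + r * \<alpha>\<^sup>2) * x1 + pconst (q * \<alpha>) * x2)
       | Y2 \<Rightarrow> y2 + (pconst q * x1 + pconst (p + r * (\<alpha> + \<alpha>\<^sup>2)) * x2)) \<in> graded_piece 1"
      by (cases v) (auto intro!: graded_piece_add lin graded_piece_pvar simp del: One_nat_def)
  qed
  then show ?thesis
    by (auto simp: graded_alg_auts_def bij_tr rhom.add[OF rhom_tr] rhom.mult[OF rhom_tr])
qed

section \<open>Free action on the nonfixed linear forms\<close>

text \<open>The determinant of the linear system takes each of the seven values \<open>\<alpha>^i\<close> once.\<close>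

lemma translation_kernel:
  assumes pqr: "p \<in> {0, 1}" "q \<in> {0, 1}" "r \<in> {0, 1::'k}"
    and eq: "d1 * (p + r * \<alpha>\<^sup>2) + d2 * q = 0" "d1 * (q * \<alpha>) + d2 * (p + r * (\<alpha> + \<alpha>\<^sup>2)) = 0"
    and d: "d1 \<noteq> 0 \<or> d2 \<noteq> 0"
  shows "p = 0 \<and> q = 0 \<and> r = 0"
proof (rule ccontr)
  assume nz: "\<not> (p = 0 \<and> q = 0 \<and> r = 0)"
  define A C where "A = p + r * \<alpha>\<^sup>2" and "C = p + r * (\<alpha> + \<alpha>\<^sup>2)"
  \<comment> \<open>The determinant of the system in \<open>d1\<close>, \<open>d2\<close>, with plus
    for minus in characteristic 2; the two identities that follow multiply by the adjugate
    matrix.\<close>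
  define D where "D = A * C + q * q * \<alpha>"
  have "d1 * D = C * (d1 * A + d2 * q) + q * (d1 * (q * \<alpha>) + d2 * C)"
    by (simp add: D_def k.char2_norm)
  moreover have "d2 * D = A * (d1 * (q * \<alpha>) + d2 * C) + q * \<alpha> * (d1 * A + d2 * q)"
    by (simp add: D_def k.char2_norm)
  ultimately have "d1 * D = 0" "d2 * D = 0"
    using eq by (simp_all add: A_def C_def)
  with d have "D = 0"
    by auto
  moreover have "D = (if q = 0 then if r = 0 then 1 else if p = 0 then \<alpha>^6 else \<alpha>^4
      else if r = 0 then if p = 0 then \<alpha> else \<alpha>^3 else if p = 0 then \<alpha>^5 else \<alpha>^2)"
    using pqr nz unfolding D_def A_def C_def
    by (elim insertE emptyE) (simp_all add: k.char2_norm)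
  moreover have "\<alpha> ^ n \<noteq> 0" for n
    using \<alpha>_nonzero by simp
  ultimately show False
    using \<alpha>_nonzero by (metis zero_neq_one)
qed

lemma linear_combination_eq_0:
  assumes "pconst u * x1 + pconst w * x2 = (0 :: (var, 'k) mpoly)"
  shows "u = 0 \<and> w = 0"
proof -
  have ne: "Poly_Mapping.single X1 (1::nat) \<noteq> Poly_Mapping.single X2 1"
    by (metis lookup_single_eq lookup_single_not_eq var.distinct(1) zero_neq_one)
  have "Poly_Mapping.single (Poly_Mapping.single X1 1) u + Poly_Mapping.single (Poly_Mapping.single X2 1) w
      = (0 :: (var, 'k) mpoly)"
    using assms by (simp add: pconst_def pvar_def mult_single)
  from arg_cong[OF this, of "\<lambda>F. Poly_Mapping.lookup F (Poly_Mapping.single X1 1)"]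
    arg_cong[OF this, of "\<lambda>F. Poly_Mapping.lookup F (Poly_Mapping.single X2 1)"]
  show ?thesis
    using ne by (simp add: lookup_add lookup_single when_def del: One_nat_def)
qed

text \<open>The change of \<open>l\<close> depends only on its coefficients \<open>d1\<close>,
  \<open>d2\<close> at \<open>y1\<close>, \<open>y2\<close>. Being moved by some \<open>tr\<close>
  forces one of them to be nonzero, and then \<open>translation_kernel\<close> applies.\<close>

lemma tr_fixes_linear_form:
  assumes l: "l \<in> linear_forms" and nonfixed: "\<exists>p q r. tr p q r l \<noteq> l"
    and pqr: "p \<in> {0, 1}" "q \<in> {0, 1}" "r \<in> {0, 1}" and fixed: "tr p q r l = l"
  shows "p = 0 \<and> q = 0 \<and> r = 0"
proof -
  obtain c1 c2 d1 d2 where lin: "l = pconst c1 * x1 + pconst c2 * x2 + pconst d1 * y1 + pconst d2 * y2"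
    using linear_form_expansion[OF l] by (simp add: UNIV_var add.assoc)
  have tr_l: "tr p q r l = l + (pconst (d1 * (p + r * \<alpha>\<^sup>2) + d2 * q) * x1
      + pconst (d1 * (q * \<alpha>) + d2 * (p + r * (\<alpha> + \<alpha>\<^sup>2))) * x2)" for p q r
    by (simp add: lin rhom.add[OF rhom_tr] rhom.mult[OF rhom_tr] pconst_add pconst_mult algebra_simps)
  have "d1 \<noteq> 0 \<or> d2 \<noteq> 0"
    using nonfixed tr_l by auto
  moreover have "d1 * (p + r * \<alpha>\<^sup>2) + d2 * q = 0 \<and> d1 * (q * \<alpha>) + d2 * (p + r * (\<alpha> + \<alpha>\<^sup>2)) = 0"
    using fixed tr_l[of p q r] by (intro linear_combination_eq_0) simp
  ultimately show ?thesis
    using translation_kernel[OF pqr] by blast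
qed

text \<open>Two elements agreeing on \<open>l\<close> have a composite fixing \<open>l\<close>,
  since each is its own inverse; its parameters are the sums, which must vanish. Both the orbit size
  and, with \<open>l = y1\<close>, faithfulness follow from this.\<close>

lemma inj_on_tr_linear_form:
  assumes l: "l \<in> linear_forms" and nonfixed: "\<exists>p q r. tr p q r l \<noteq> l"
  shows "inj_on (\<lambda>(p, q, r). tr p q r l) ({0, 1} \<times> {0, 1} \<times> {0, 1})"
proof (rule inj_onI)
  fix s t :: "'k \<times> 'k \<times> 'k"
  assume mem': "s \<in> {0, 1} \<times> {0, 1} \<times> {0, 1}" "t \<in> {0, 1} \<times> {0, 1} \<times> {0, 1}"
    and eq': "(case s of (p, q, r) \<Rightarrow> tr p q r l) = (case t of (p, q, r) \<Rightarrow> tr p q r l)"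
  obtain p q r p' q' r' where st: "s = (p, q, r)" "t = (p', q', r')"
    by (cases s; cases t) blast
  have mem: "p \<in> {0, 1}" "q \<in> {0, 1}" "r \<in> {0, 1}" "p' \<in> {0, 1}" "q' \<in> {0, 1}" "r' \<in> {0, 1}"
    using mem' by (auto simp: st simp del: insert_Times_insert)
  have eq: "tr p q r l = tr p' q' r' l"
    using eq' by (simp add: st)
  have "tr (p + p') (q + q') (r + r') l = tr p q r (tr p' q' r' l)"
    by (simp flip: tr_comp)
  also have "\<dots> = l"
    unfolding eq[symmetric] using tr_self_inverse by (metis comp_apply id_apply)
  finally have "tr (p + p') (q + q') (r + r') l = l" .
  moreover have "u + w \<in> {0, 1}" if "u \<in> {0, 1}" "w \<in> {0, 1}" for u w :: 'k
    using that by (auto simp: two_k)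
  then have "p + p' \<in> {0, 1}" "q + q' \<in> {0, 1}" "r + r' \<in> {0, 1}"
    using mem by blast+
  ultimately have "p + p' = 0 \<and> q + q' = 0 \<and> r + r' = 0"
    using tr_fixes_linear_form[OF l nonfixed] by blast
  then show "s = t"
    using k.add_eq_0D by (simp add: st)
qed

lemma y1_nonfixed: "\<exists>p q r. tr p q r y1 \<noteq> y1"
proof -
  have "tr 1 0 0 y1 \<noteq> y1"
    using pvar_nonzero by simp
  then show ?thesis by blast
qed

section \<open>Identification of the group with the cube of C2\<close>

abbreviation "cube_points \<equiv> {0, 1 :: 'k} \<times> {0, 1 :: 'k} \<times> {0, 1 :: 'k}"

lemma card_cube_points: "card cube_points = 8"
  by (simp add: card_cartesian_product del: insert_Times_insert)

text \<open>Residues modulo 2 are integers here; casting them into the field is compatible with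
  reduction because \<open>2 = 0\<close> there.\<close>

definition C2_cubed_to_tr :: "int \<times> int \<times> int \<Rightarrow> (var, 'k) mpoly \<Rightarrow> (var, 'k) mpoly" where
  "C2_cubed_to_tr = (\<lambda>(i, j, l). tr (of_int i) (of_int j) (of_int l))"

lemma of_int_mod_2: "(of_int (i mod 2) :: 'k) = of_int i"
proof -
  have "(of_int i :: 'k) = of_int (i div 2 * 2 + i mod 2)"
    by simp
  also have "\<dots> = of_int (i mod 2)"
    unfolding of_int_add of_int_mult by (simp add: two_k)
  finally show ?thesis ..
qed

lemma carrier_C2: "carrier C2 = {0, 1}"
  by (auto simp: carrier_integer_mod_group)

lemma group_C2_cubed: "group (C2 \<times>\<times> C2 \<times>\<times> C2)"
  by (intro DirProd_group) simp_all

lemma C2_cubed_to_tr_image: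
  "C2_cubed_to_tr ` carrier (C2 \<times>\<times> C2 \<times>\<times> C2) = (\<lambda>(p, q, r). tr p q r) ` cube_points"
  by (auto simp: C2_cubed_to_tr_def carrier_C2 image_iff)

lemma C2_cubed_to_tr_hom: "C2_cubed_to_tr \<in> hom (C2 \<times>\<times> C2 \<times>\<times> C2) (BijGroup UNIV)"
proof (rule homI)
  fix s assume "s \<in> carrier (C2 \<times>\<times> C2 \<times>\<times> C2)"
  show "C2_cubed_to_tr s \<in> carrier (BijGroup UNIV)"
    by (simp add: carrier_BijGroup C2_cubed_to_tr_def bij_tr split: prod.split)
next
  fix s t
  show "C2_cubed_to_tr (s \<otimes>\<^bsub>C2 \<times>\<times> C2 \<times>\<times> C2\<^esub> t)
    = C2_cubed_to_tr s \<otimes>\<^bsub>BijGroup UNIV\<^esub> C2_cubed_to_tr t"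
    by (cases s; cases t) (simp add: C2_cubed_to_tr_def mult_BijGroup bij_tr tr_comp of_int_mod_2)
qed

lemma inj_on_C2_cubed_to_tr: "inj_on C2_cubed_to_tr (carrier (C2 \<times>\<times> C2 \<times>\<times> C2))"
proof (rule inj_onI)
  fix s t
  assume "s \<in> carrier (C2 \<times>\<times> C2 \<times>\<times> C2)" "t \<in> carrier (C2 \<times>\<times> C2 \<times>\<times> C2)"
    and eq: "C2_cubed_to_tr s = C2_cubed_to_tr t"
  moreover obtain i j l i' j' l' where st: "s = (i, j, l)" "t = (i', j', l')"
    by (cases s; cases t) blast
  ultimately have mem: "i \<in> {0, 1}" "j \<in> {0, 1}" "l \<in> {0, 1}" "i' \<in> {0, 1}" "j' \<in> {0, 1}" "l' \<in> {0, 1}"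
    by (auto simp: carrier_C2 simp del: insert_Times_insert)
  have "(of_int i, of_int j, of_int l) = (of_int i' :: 'k, of_int j' :: 'k, of_int l' :: 'k)"
  proof (rule inj_onD[OF inj_on_tr_linear_form[OF graded_piece_pvar y1_nonfixed]])
    show "(case (of_int i, of_int j, of_int l) of (p, q, r) \<Rightarrow> tr p q r y1)
      = (case (of_int i', of_int j', of_int l') of (p, q, r) \<Rightarrow> tr p q r y1)"
      using fun_cong[OF eq, of y1] by (simp add: C2_cubed_to_tr_def st del: tr_simps)
  qed (use mem in \<open>auto simp del: insert_Times_insert\<close>)
  then show "s = t"
    using mem by (auto simp: st)
qed

lemma grp_eq: "grp \<alpha> = (\<lambda>(p, q, r). tr p q r) ` cube_points"
proof -
  interpret BG: group "BijGroup (UNIV :: (var, 'k) mpoly set)"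
    by (rule group_BijGroup)
  have gh: "group_hom (C2 \<times>\<times> C2 \<times>\<times> C2) (BijGroup UNIV) C2_cubed_to_tr"
    by (simp add: group_hom_def group_hom_axioms_def group_C2_cubed C2_cubed_to_tr_hom BG.is_group)
  have sub: "subgroup ((\<lambda>(p, q, r). tr p q r) ` cube_points) (BijGroup UNIV)"
    using group_hom.img_is_subgroup[OF gh] unfolding C2_cubed_to_tr_image .
  have "{\<sigma>, \<tau> \<alpha>, \<rho> \<alpha>} \<subseteq> (\<lambda>(p, q, r). tr p q r) ` cube_points"
    by (auto simp: tr_generators image_iff)
  then have "grp \<alpha> \<subseteq> (\<lambda>(p, q, r). tr p q r) ` cube_points"
    unfolding grp_def by (rule BG.generate_subgroup_incl[OF _ sub])
  moreover have "tr p q r \<in> grp \<alpha>" if "p \<in> {0, 1}" "q \<in> {0, 1}" "r \<in> {0, 1}" for p q r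
  proof -
    have closed: "s \<circ> t \<in> grp \<alpha>" if "s \<in> grp \<alpha>" "t \<in> grp \<alpha>" "bij s" "bij t" for s t
      using generate.eng[of s "BijGroup UNIV" _ t] that unfolding grp_def by (simp add: mult_BijGroup)
    have gens: "tr 1 0 0 \<in> grp \<alpha>" "tr 0 1 0 \<in> grp \<alpha>" "tr 0 0 1 \<in> grp \<alpha>"
      unfolding grp_def tr_generators[symmetric] by (auto intro: generate.incl)
    \<comment> \<open>The identity is the square of a generator; it covers the parameters equal to 0
      in the product below.\<close>
    then have "tr 0 0 0 \<in> grp \<alpha>"
      using closed[of "tr 1 0 0" "tr 1 0 0"] by (simp add: bij_tr tr_self_inverse tr_0)
    with gens that have 1: "tr p 0 0 \<in> grp \<alpha>" "tr 0 q 0 \<in> grp \<alpha>" "tr 0 0 r \<in> grp \<alpha>"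
      by auto
    then have "tr p 0 0 \<circ> tr 0 q 0 \<in> grp \<alpha>"
      by (intro closed bij_tr)
    with 1 have "(tr p 0 0 \<circ> tr 0 q 0) \<circ> tr 0 0 r \<in> grp \<alpha>"
      by (intro closed bij_tr bij_comp)
    then show ?thesis
      by (simp add: tr_comp)
  qed
  ultimately show ?thesis
    by auto
qed

lemma grp_subset_tr: "s \<in> grp \<alpha> \<Longrightarrow> \<exists>p q r. s = tr p q r"
  unfolding grp_eq by auto

lemma tr_in_grp: "p \<in> {0, 1} \<Longrightarrow> q \<in> {0, 1} \<Longrightarrow> r \<in> {0, 1} \<Longrightarrow> tr p q r \<in> grp \<alpha>"
  unfolding grp_eq by force

lemma subgroup_grp: "subgroup (grp \<alpha>) (BijGroup UNIV)"
  unfolding grp_def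
  by (rule group.generate_is_subgroup[OF group_BijGroup])
     (auto simp: carrier_BijGroup tr_generators bij_tr)

lemma grp_graded: "grp \<alpha> \<subseteq> graded_alg_auts"
  using grp_subset_tr tr_graded_alg_aut by blast

lemma grp_iso: "(BijGroup UNIV)\<lparr>carrier := grp \<alpha>\<rparr> \<cong> C2 \<times>\<times> C2 \<times>\<times> C2"
proof -
  have "C2_cubed_to_tr \<in> iso (C2 \<times>\<times> C2 \<times>\<times> C2) ((BijGroup UNIV)\<lparr>carrier := grp \<alpha>\<rparr>)"
    using C2_cubed_to_tr_hom inj_on_C2_cubed_to_tr C2_cubed_to_tr_image
    by (auto simp: iso_def hom_def bij_betw_def grp_eq)
  then show ?thesis
    using group.iso_sym[OF group_C2_cubed] is_isoI by blast
qed

lemma card_grp: "card (grp \<alpha>) = 8"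
proof -
  have "inj_on (\<lambda>(p, q, r). tr p q r) cube_points"
    using inj_on_tr_linear_form[OF graded_piece_pvar y1_nonfixed]
    by (auto simp: inj_on_def simp del: tr_simps)
  then show ?thesis
    unfolding grp_eq by (simp add: card_image card_cube_points del: insert_Times_insert)
qed

lemma inv_ring_grp: "inv_ring (grp \<alpha>) = alg_gen B"
proof -
  have "F \<in> inv_ring (grp \<alpha>) \<longleftrightarrow> \<sigma> F = F \<and> \<tau> \<alpha> F = F \<and> \<rho> \<alpha> F = F" for F
  proof
    assume F: "F \<in> inv_ring (grp \<alpha>)"
    then show "\<sigma> F = F \<and> \<tau> \<alpha> F = F \<and> \<rho> \<alpha> F = F"
      by (auto simp: inv_ring_def tr_generators tr_in_grp)
  next
    assume F: "\<sigma> F = F \<and> \<tau> \<alpha> F = F \<and> \<rho> \<alpha> F = F"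
    have "tr p q r F = F" if "p \<in> {0, 1}" "q \<in> {0, 1}" "r \<in> {0, 1}" for p q r
    proof -
      have "tr p 0 0 F = F" "tr 0 q 0 F = F" "tr 0 0 r F = F"
        using F that by (auto simp: tr_generators tr_0)
      moreover have "tr p q r = tr p 0 0 \<circ> (tr 0 q 0 \<circ> tr 0 0 r)"
        by (simp add: tr_comp)
      ultimately show ?thesis
        by simp
    qed
    then show "F \<in> inv_ring (grp \<alpha>)"
      by (auto simp: inv_ring_def grp_eq)
  qed
  then show ?thesis
    by (auto simp: invariants_eq_alg_gen)
qed

lemma min_hom_gen_set_B: "min_hom_gen_set B (inv_ring (grp \<alpha>))"
proof -
  have "\<exists>d. r \<in> graded_piece d" if "r \<in> B" for r
    using that graded_generators graded_piece_pvar by blast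
  then show ?thesis
    using generators_minimal by (auto simp: min_hom_gen_set_def inv_ring_grp)
qed

section \<open>Orbit norms\<close>

lemma form_orbit_grp: "form_orbit (grp \<alpha>) l = (\<lambda>(p, q, r). tr p q r l) ` cube_points"
  unfolding form_orbit_def grp_eq by auto

lemma nonfixed_formsD:
  assumes "l \<in> nonfixed_forms (grp \<alpha>)"
  shows "l \<in> linear_forms" "\<exists>p q r. tr p q r l \<noteq> l"
  using assms grp_subset_tr by (fastforce simp: nonfixed_forms_def inv_ring_def)+

lemma card_form_orbit: "l \<in> nonfixed_forms (grp \<alpha>) \<Longrightarrow> card (form_orbit (grp \<alpha>) l) = 8"
  unfolding form_orbit_grp
  by (subst card_image[OF inj_on_tr_linear_form[OF nonfixed_formsD]]) (simp_all only: card_cube_points)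

lemma finite_form_orbit: "finite (form_orbit (grp \<alpha>) l)"
  unfolding form_orbit_grp by simp

lemma orbit_norm_nonzero:
  assumes "l \<in> nonfixed_forms (grp \<alpha>)"
  shows "orbit_norm (grp \<alpha>) l \<noteq> 0"
proof -
  have "l \<noteq> 0"
    using nonfixed_formsD(2)[OF assms] rhom.zero[OF rhom_tr] by auto
  then have "tr p q r l \<noteq> 0" for p q r
    using tr_self_inverse rhom.zero[OF rhom_tr] by (metis comp_apply id_apply)
  then show ?thesis
    by (auto simp: orbit_norm_def finite_form_orbit form_orbit_grp)
qed

lemma orbit_norm_graded:
  assumes "l \<in> nonfixed_forms (grp \<alpha>)"
  shows "orbit_norm (grp \<alpha>) l \<in> graded_piece 8"
proof -
  have "s l \<in> graded_piece 1" if "s \<in> grp \<alpha>" for s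
    using that nonfixed_formsD(1)[OF assms] grp_graded unfolding graded_alg_auts_def by blast
  then have "m \<in> graded_piece 1" if "m \<in> form_orbit (grp \<alpha>) l" for m
    using that unfolding form_orbit_def by blast
  then have "orbit_norm (grp \<alpha>) l \<in> graded_piece (\<Sum>m\<in>form_orbit (grp \<alpha>) l. 1)"
    unfolding orbit_norm_def by (intro graded_piece_prod)
  then show ?thesis
    by (simp add: card_form_orbit[OF assms])
qed

text \<open>Each group element is injective and maps the finite orbit into itself, hence permutes
  the factors.\<close>

lemma orbit_norm_invariant: "orbit_norm (grp \<alpha>) l \<in> inv_ring (grp \<alpha>)"
proof -
  have "s (orbit_norm (grp \<alpha>) l) = orbit_norm (grp \<alpha>) l" if s: "s \<in> grp \<alpha>" for s
  proof -
    obtain p q r where tr: "s = tr p q r"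
      using grp_subset_tr[OF s] by blast
    have "s ` form_orbit (grp \<alpha>) l \<subseteq> form_orbit (grp \<alpha>) l"
    proof clarify
      fix m assume "m \<in> form_orbit (grp \<alpha>) l"
      then obtain t where t: "t \<in> grp \<alpha>" "m = t l"
        by (auto simp: form_orbit_def)
      have "s \<circ> t \<in> grp \<alpha>"
        using subgroup.m_closed[OF subgroup_grp s t(1)] grp_subset_tr[OF t(1)] tr
        by (auto simp: mult_BijGroup bij_tr)
      then show "s m \<in> form_orbit (grp \<alpha>) l"
        using t(2) by (auto simp: form_orbit_def intro!: exI[of _ "s \<circ> t"])
    qed
    moreover have inj: "inj_on s (form_orbit (grp \<alpha>) l)"
      using bij_tr[of p q r] tr by (auto intro: inj_on_subset simp: bij_def)
    ultimately have "s ` form_orbit (grp \<alpha>) l = form_orbit (grp \<alpha>) l"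
      by (simp add: endo_inj_surj finite_form_orbit)
    then have "(\<Prod>m\<in>form_orbit (grp \<alpha>) l. s m) = (\<Prod>m\<in>form_orbit (grp \<alpha>) l. m)"
      using prod.reindex[OF inj, of "\<lambda>m. m"] by simp
    then show ?thesis
      by (simp add: orbit_norm_def tr rhom.prod[OF rhom_tr])
  qed
  then show ?thesis
    by (simp add: inv_ring_def)
qed

lemma hcomp_invariant:
  assumes "F \<in> inv_ring (grp \<alpha>)"
  shows "hcomp d F \<in> inv_ring (grp \<alpha>)"
proof -
  have "s (hcomp d F) = hcomp d F" if "s \<in> grp \<alpha>" for s
    using hcomp_graded_hom[OF subsetD[OF grp_graded that], of d F] that assms by (auto simp: inv_ring_def)
  then show ?thesis
    by (simp add: inv_ring_def)
qed

lemma hcomp_inv_ring_pos: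
  assumes "F \<in> inv_ring (grp \<alpha>)" "d > 0"
  shows "hcomp d F \<in> inv_ring_pos (grp \<alpha>)"
  using assms hcomp_invariant by (auto simp: inv_ring_pos_def lookup_hcomp)

text \<open>All generators have degree at most \<open>6\<close>, so higher components are decomposable.\<close>

lemma hcomp_decomposable:
  assumes "F \<in> alg_gen B" "d > 6"
  shows "hcomp d F \<in> ideal_square (inv_ring_pos (grp \<alpha>))"
  using assms(1)
proof induction
  case (const c)
  then show ?case
    using assms(2) by (simp add: hcomp_of_graded_piece[OF graded_piece_pconst] ideal_square_0)
next
  case (gen r)
  then obtain e where "r \<in> graded_piece e" "e \<le> 6"
    using graded_generators graded_piece_pvar[of X1, where ?'b = 'k] graded_piece_pvar[of X2, where ?'b = 'k] by fastforce
  then show ?case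
    using assms(2) by (simp add: hcomp_of_graded_piece ideal_square_0)
next
  case (add F G)
  then show ?case by (simp add: hcomp_add ideal_square_add)
next
  case (mult F G)
  \<comment> \<open>For the end terms \<open>i = 0\<close> and \<open>i = d\<close> of the product
    formula, where one factor is a constant and the other lies in the square by induction.\<close>
  have scale: "pconst c * s \<in> ideal_square (inv_ring_pos (grp \<alpha>))"
    if "s \<in> ideal_square (inv_ring_pos (grp \<alpha>))" for c s
  proof (rule ideal_square_scale[OF _ that])
    fix y assume "y \<in> inv_ring_pos (grp \<alpha>)"
    moreover have "hcomp 0 (pconst c * y) = pconst c * hcomp 0 y"
      by (simp add: hcomp_mult hcomp_of_graded_piece[OF graded_piece_pconst])
    ultimately show "pconst c * y \<in> inv_ring_pos (grp \<alpha>)"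
      using pconst_inject[of _ 0]
      by (auto simp: inv_ring_pos_def inv_ring_grp hcomp_0_eq_pconst intro!: alg_gen.mult alg_gen.const
          simp flip: pconst_mult)
  qed
  have "hcomp i F * hcomp (d - i) G \<in> ideal_square (inv_ring_pos (grp \<alpha>))" if i: "i \<le> d" for i
  proof -
    consider "i = 0" | "i = d" | "0 < i" "0 < d - i"
      using i by (metis le_neq_implies_less not_gr_zero zero_less_diff)
    then show ?thesis
    proof cases
      case 1
      then show ?thesis
        using scale[OF mult.IH(2)] by (simp add: hcomp_0_eq_pconst)
    next
      case 2
      then show ?thesis
        using scale[OF mult.IH(1)] by (simp add: hcomp_0_eq_pconst mult.commute[of "hcomp d F"])
    next
      case 3
      then show ?thesis
        using mult.hyps by (intro ideal_square_mult hcomp_inv_ring_pos) (simp_all add: inv_ring_grp)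
    qed
  qed
  then show ?case
    by (auto simp: hcomp_mult intro: ideal_square_sum)
qed

lemma orbit_norm_decomposable:
  assumes "l \<in> nonfixed_forms (grp \<alpha>)"
  shows "orbit_norm (grp \<alpha>) l \<in> ideal_square (inv_ring_pos (grp \<alpha>))"
  using hcomp_decomposable[of "orbit_norm (grp \<alpha>) l" 8] orbit_norm_invariant[of l]
    hcomp_of_graded_piece[OF orbit_norm_graded[OF assms], of 8]
  by (simp add: inv_ring_grp)

end

theorem theorem1p1:
  fixes \<alpha> :: "'k::field"
  assumes "CARD('k) = 8" and "\<alpha> ^ 3 = \<alpha> + 1"
  shows
    "subgroup (grp \<alpha>) (BijGroup UNIV) \<and> grp \<alpha> \<subseteq> graded_alg_auts \<and>
     (BijGroup UNIV)\<lparr>carrier := grp \<alpha>\<rparr> \<cong> C2 \<times>\<times> C2 \<times>\<times> C2 \<and>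
     (\<exists>fs. list_all2 (\<lambda>d f. f \<in> graded_piece d) [1, 1, 4, 4, 6] fs \<and> distinct fs \<and>
           min_hom_gen_set (set fs) (inv_ring (grp \<alpha>))) \<and>
     (\<forall>l\<in>nonfixed_forms (grp \<alpha>). card (form_orbit (grp \<alpha>) l) = 8) \<and>
     (\<forall>l\<in>nonfixed_forms (grp \<alpha>).
        orbit_norm (grp \<alpha>) l \<noteq> 0 \<and> orbit_norm (grp \<alpha>) l \<in> graded_piece 8 \<and>
        orbit_norm (grp \<alpha>) l \<in> ideal_square (inv_ring_pos (grp \<alpha>))) \<and>
     (\<forall>l\<in>nonfixed_forms (grp \<alpha>). \<forall>A.
        min_hom_gen_set A (inv_ring (grp \<alpha>)) \<longrightarrow> orbit_norm (grp \<alpha>) l \<notin> A) \<and>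
     \<not> unrestricted_norm_conjecture TYPE(var) TYPE('k)"
proof -
  \<comment> \<open>Translation by 1 permutes the field, so summing over all elements gives
    \<open>8 = 0\<close>; as \<open>8 = 2^3\<close>, the characteristic is 2.\<close>
  have "(\<Sum>x\<in>UNIV. x + 1) = (\<Sum>x\<in>UNIV. x :: 'k)"
    by (rule sum.reindex_bij_witness[of _ "\<lambda>x. x - 1" "\<lambda>x. x + 1"]) auto
  then have char: "of_nat 8 = (0 :: 'k)"
    using assms(1) card_ge_0_finite[of "UNIV :: 'k set"] by (simp add: sum.distrib)
  moreover have "of_nat 8 = (2 :: 'k) ^ 3"
    by simp
  ultimately have "(2 :: 'k) = 0"
    by (metis power_eq_0_iff)
  then interpret counterexample \<alpha>
    using assms(2) by unfold_locales
  have gens: "\<exists>fs. list_all2 (\<lambda>d f. f \<in> graded_piece d) [1, 1, 4, 4, 6] fs \<and> distinct fs \<and>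
           min_hom_gen_set (set fs) (inv_ring (grp \<alpha>))"
    by (rule exI[of _ "[x1, x2, f, g, h]"])
       (use min_hom_gen_set_B distinct_generators graded_generators graded_piece_pvar in \<open>simp del: One_nat_def\<close>)
  have notin: "orbit_norm (grp \<alpha>) l \<notin> A"
    if "l \<in> nonfixed_forms (grp \<alpha>)" "min_hom_gen_set A (inv_ring (grp \<alpha>))" for l A
    using that decomposable_notin_min_hom_gen_set orbit_norm_graded orbit_norm_decomposable by blast
  have "finite (grp \<alpha>)"
    using card_grp by (simp add: card_ge_0_finite)
  moreover have "CHAR('k) dvd card (grp \<alpha>)"
    using char by (simp only: of_nat_eq_0_iff_char_dvd card_grp)
  ultimately have "\<not> unrestricted_norm_conjecture TYPE(var) TYPE('k)"
    unfolding unrestricted_norm_conjecture_def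
    using subgroup_grp grp_graded notin by blast
  then show ?thesis
    using subgroup_grp grp_graded grp_iso gens card_form_orbit orbit_norm_nonzero orbit_norm_graded
      orbit_norm_decomposable notin by blast
qed

end
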